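(* Let $(\mathcal A,\delta)$ be a $C^*$-dynamical system, let $(\pi,U,H)$ be a covariant representation of $(\mathcal A,\delta)$ and let $$I=\{a\in\mathcal A:(1-U^*U)\pi(a)=\pi(a)\},\qquad J=\{a\in\mathcal A: U^*U\pi(a)=\pi(a)\}.$$ Then $I$ is the kernel of $\delta$ and $J$ is an ideal orthogonal to $I$. Moreover, if $(\mathcal A_J,\delta_J)$ is the extension of $(\mathcal A,\delta)$ associated with $J$, then $\pi$ uniquely extends to an isomorphism $\widetilde\pi:\mathcal A_J\to C^*(\pi(\mathcal A),U^*U)$ such that $(\widetilde\pi,U,H)$ is a covariant representation of $(\mathcal A_J,\delta_J)$. Namely, $\widetilde\pi$ is given by $$\widetilde\pi\big((a+I)\oplus(b+J)\big)=U^*U\pi(a)+(1-U^*U)\pi(b),\qquad a,b\in\mathcal A.$$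
   Context: A $C^*$-dynamical system $(\mathcal A,\delta)$ is a unital $C^*$-algebra $\mathcal A$ with a $*$-endomorphism $\delta:\mathcal A\to\mathcal A$ (not assumed unital or injective). A covariant representation of $(\mathcal A,\delta)$ is a triple $(\pi,U,H)$ where $\pi:\mathcal A\to\mathcal B(H)$ is a non-degenerate faithful $*$-representation on a Hilbert space $H$ and $U\in\mathcal B(H)$ is a partial isometry with $U\pi(a)U^*=\pi(\delta(a))$ for all $a\in\mathcal A$ and $U^*U\in\pi(\mathcal A)'$ (the commutant). Ideals are closed and two-sided. An ideal $J$ is orthogonal to an ideal $I$ if $I\cap J=\{0\}$. For $I=\operatorname{Ker}\delta$ and an ideal $J$ orthogonal to $I$, put $\mathcal A_J=(\mathcal A/I)\oplus(\mathcal A/J)$ and define the endomorphism $\delta_J:\mathcal A_J\to\mathcal A_J$ by $\delta_J\big((a+I)\oplus(b+J)\big)=(\delta(a)+I)\oplus(\delta(a)+J)$. The algebra $\mathcal A$ is identified with a subalgebra of $\mathcal A_J$ via the injective map $a\mapsto(a+I)\oplus(a+J)$; under this identification $\delta_J$ extends $\delta$. $C^*(\pi(\mathcal A),U^*U)$ denotes the $C^*$-subalgebra of $\mathcal B(H)$ generated by $\pi(\mathcal A)$ and $U^*U$. *)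

theory Defs
  imports "HOL-Analysis.Analysis" "HOL-Algebra.Chinese_Remainder"
begin

section \<open>Unital C*-algebras with explicit carrier\<close>

record 'a cstar_alg = "'a ring" +
  cscale :: "complex \<Rightarrow> 'a \<Rightarrow> 'a"
  star :: "'a \<Rightarrow> 'a"
  cnorm :: "'a \<Rightarrow> real"

definition norm_lim :: "('a, 'm) cstar_alg_scheme \<Rightarrow> (nat \<Rightarrow> 'a) \<Rightarrow> 'a \<Rightarrow> bool" where
  "norm_lim A s x \<longleftrightarrow> (\<lambda>n. cnorm A (s n \<ominus>\<^bsub>A\<^esub> x)) \<longlonglongrightarrow> 0"

text \<open>The zero algebra is allowed: a quotient \<open>A/J\<close> may be zero.\<close>

locale cstar_algebra = ring A for A :: "('a, 'm) cstar_alg_scheme" (structure) +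
  assumes cscale_closed: "x \<in> carrier A \<Longrightarrow> cscale A c x \<in> carrier A"
    and cscale_add_right: "x \<in> carrier A \<Longrightarrow> y \<in> carrier A \<Longrightarrow>
          cscale A c (x \<oplus> y) = cscale A c x \<oplus> cscale A c y"
    and cscale_add_left: "x \<in> carrier A \<Longrightarrow> cscale A (c + d) x = cscale A c x \<oplus> cscale A d x"
    and cscale_cscale: "x \<in> carrier A \<Longrightarrow> cscale A c (cscale A d x) = cscale A (c * d) x"
    and cscale_one: "x \<in> carrier A \<Longrightarrow> cscale A 1 x = x"
    and cscale_mult_left: "x \<in> carrier A \<Longrightarrow> y \<in> carrier A \<Longrightarrow>
          cscale A c x \<otimes> y = cscale A c (x \<otimes> y)"
    and cscale_mult_right: "x \<in> carrier A \<Longrightarrow> y \<in> carrier A \<Longrightarrow>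
          x \<otimes> cscale A c y = cscale A c (x \<otimes> y)"
    and star_closed: "x \<in> carrier A \<Longrightarrow> star A x \<in> carrier A"
    and star_star: "x \<in> carrier A \<Longrightarrow> star A (star A x) = x"
    and star_add: "x \<in> carrier A \<Longrightarrow> y \<in> carrier A \<Longrightarrow> star A (x \<oplus> y) = star A x \<oplus> star A y"
    and star_mult: "x \<in> carrier A \<Longrightarrow> y \<in> carrier A \<Longrightarrow> star A (x \<otimes> y) = star A y \<otimes> star A x"
    and star_cscale: "x \<in> carrier A \<Longrightarrow> star A (cscale A c x) = cscale A (cnj c) (star A x)"
    and cnorm_ge_zero: "x \<in> carrier A \<Longrightarrow> 0 \<le> cnorm A x"
    and cnorm_eq_zero: "x \<in> carrier A \<Longrightarrow> cnorm A x = 0 \<longleftrightarrow> x = \<zero>"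
    and cnorm_triangle: "x \<in> carrier A \<Longrightarrow> y \<in> carrier A \<Longrightarrow>
          cnorm A (x \<oplus> y) \<le> cnorm A x + cnorm A y"
    and cnorm_cscale: "x \<in> carrier A \<Longrightarrow> cnorm A (cscale A c x) = cmod c * cnorm A x"
    and cnorm_mult: "x \<in> carrier A \<Longrightarrow> y \<in> carrier A \<Longrightarrow>
          cnorm A (x \<otimes> y) \<le> cnorm A x * cnorm A y"
    and cstar_identity: "x \<in> carrier A \<Longrightarrow> cnorm A (star A x \<otimes> x) = (cnorm A x)\<^sup>2"
    and complete: "range s \<subseteq> carrier A \<Longrightarrow>
          \<forall>e>0. \<exists>N. \<forall>m\<ge>N. \<forall>n\<ge>N. cnorm A (s m \<ominus> s n) < e \<Longrightarrow>
          \<exists>x\<in>carrier A. norm_lim A s x"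

definition norm_closed :: "('a, 'm) cstar_alg_scheme \<Rightarrow> 'a set \<Rightarrow> bool" where
  "norm_closed A S \<longleftrightarrow>
     (\<forall>s x. range s \<subseteq> S \<longrightarrow> x \<in> carrier A \<longrightarrow> norm_lim A s x \<longrightarrow> x \<in> S)"

text \<open>Complex scalars need no mention here: \<open>A\<close> is unital, so a ring ideal is a complex subspace.\<close>

definition closed_ideal :: "('a, 'm) cstar_alg_scheme \<Rightarrow> 'a set \<Rightarrow> bool" where
  "closed_ideal A I \<longleftrightarrow> ideal I A \<and> norm_closed A I"

definition orthogonal_ideals :: "('a, 'm) cstar_alg_scheme \<Rightarrow> 'a set \<Rightarrow> 'a set \<Rightarrow> bool" where
  "orthogonal_ideals A I J \<longleftrightarrow> closed_ideal A I \<and> closed_ideal A J \<and> I \<inter> J = {\<zero>\<^bsub>A\<^esub>}"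

text \<open>Not necessarily unital *-homomorphisms, in contrast to \<^const>\<open>ring_hom\<close>.\<close>

definition star_hom ::
  "('a, 'm) cstar_alg_scheme \<Rightarrow> ('b, 'n) cstar_alg_scheme \<Rightarrow> ('a \<Rightarrow> 'b) set" where
  "star_hom A B = {f \<in> carrier A \<rightarrow> carrier B.
     (\<forall>x\<in>carrier A. \<forall>y\<in>carrier A. f (x \<oplus>\<^bsub>A\<^esub> y) = f x \<oplus>\<^bsub>B\<^esub> f y) \<and>
     (\<forall>x\<in>carrier A. \<forall>y\<in>carrier A. f (x \<otimes>\<^bsub>A\<^esub> y) = f x \<otimes>\<^bsub>B\<^esub> f y) \<and>
     (\<forall>c. \<forall>x\<in>carrier A. f (cscale A c x) = cscale B c (f x)) \<and>
     (\<forall>x\<in>carrier A. f (star A x) = star B (f x))}"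

definition star_iso ::
  "('a, 'm) cstar_alg_scheme \<Rightarrow> ('b, 'n) cstar_alg_scheme \<Rightarrow> ('a \<Rightarrow> 'b) set" where
  "star_iso A B = {f \<in> star_hom A B. bij_betw f (carrier A) (carrier B)}"

definition cstar_subalgebra :: "('a, 'm) cstar_alg_scheme \<Rightarrow> 'a set \<Rightarrow> bool" where
  "cstar_subalgebra A S \<longleftrightarrow> S \<subseteq> carrier A \<and> \<zero>\<^bsub>A\<^esub> \<in> S \<and>
     (\<forall>x\<in>S. \<forall>y\<in>S. x \<oplus>\<^bsub>A\<^esub> y \<in> S) \<and> (\<forall>x\<in>S. \<forall>y\<in>S. x \<otimes>\<^bsub>A\<^esub> y \<in> S) \<and>
     (\<forall>c. \<forall>x\<in>S. cscale A c x \<in> S) \<and> (\<forall>x\<in>S. star A x \<in> S) \<and> norm_closed A S"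

definition cstar_generated ::
  "('a, 'm) cstar_alg_scheme \<Rightarrow> 'a set \<Rightarrow> ('a, 'm) cstar_alg_scheme" where
  "cstar_generated A X = A\<lparr>carrier := \<Inter>{S. cstar_subalgebra A S \<and> X \<subseteq> S}\<rparr>"

text \<open>The quotient operations are given as unions over representatives, as in \<^const>\<open>rcoset_mult\<close>;
  the norm is the quotient norm, \<open>inf {\<parallel>a + i\<parallel> | i \<in> I}\<close> on \<open>a + I\<close>.\<close>

definition cstar_quotient :: "('a, 'm) cstar_alg_scheme \<Rightarrow> 'a set \<Rightarrow> 'a set cstar_alg" where
  "cstar_quotient A I = ring.extend (A Quot I)
     (cstar_alg.fields
       (\<lambda>c X. \<Union>x\<in>X. I +>\<^bsub>A\<^esub> cscale A c x)
       (\<lambda>X. \<Union>x\<in>X. I +>\<^bsub>A\<^esub> star A x)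
       (\<lambda>X. Inf (cnorm A ` X)))"

definition cstar_sum ::
  "('a, 'm) cstar_alg_scheme \<Rightarrow> ('b, 'n) cstar_alg_scheme \<Rightarrow> ('a \<times> 'b) cstar_alg" where
  "cstar_sum A B = ring.extend (RDirProd A B)
     (cstar_alg.fields
       (\<lambda>c (x, y). (cscale A c x, cscale B c y))
       (\<lambda>(x, y). (star A x, star B y))
       (\<lambda>(x, y). max (cnorm A x) (cnorm B y)))"


section \<open>Operators on a complex Hilbert space\<close>

text \<open>The inner product is linear in the first argument.\<close>

class chilbert_space = banach +
  fixes scaleC :: "complex \<Rightarrow> 'a \<Rightarrow> 'a" (infixr \<open>*\<^sub>C\<close> 75)
    and cinner :: "'a \<Rightarrow> 'a \<Rightarrow> complex"
  assumes scaleR_scaleC: "r *\<^sub>R x = complex_of_real r *\<^sub>C x"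
    and scaleC_add_right: "c *\<^sub>C (x + y) = c *\<^sub>C x + c *\<^sub>C y"
    and scaleC_add_left: "(c + d) *\<^sub>C x = c *\<^sub>C x + d *\<^sub>C x"
    and scaleC_scaleC: "c *\<^sub>C d *\<^sub>C x = (c * d) *\<^sub>C x"
    and scaleC_one: "1 *\<^sub>C x = x"
    and cinner_add_left: "cinner (x + y) z = cinner x z + cinner y z"
    and cinner_scaleC_left: "cinner (c *\<^sub>C x) y = c * cinner x y"
    and cinner_commute: "cinner x y = cnj (cinner y x)"
    and cinner_ge_zero: "0 \<le> Re (cinner x x)"
    and cinner_eq_zero: "cinner x x = 0 \<longleftrightarrow> x = 0"
    and norm_eq_sqrt_cinner: "norm x = sqrt (Re (cinner x x))"

definition hadjoint :: "('h::chilbert_space \<Rightarrow>\<^sub>L 'h) \<Rightarrow> ('h \<Rightarrow>\<^sub>L 'h)" (\<open>(_\<^sup>\<dagger>)\<close> [1000] 999) where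
  "T\<^sup>\<dagger> = (THE S. \<forall>x y. cinner (blinfun_apply T x) y = cinner x (blinfun_apply S y))"

text \<open>The C*-algebra \<open>B(H)\<close>. The type \<open>'h \<Rightarrow>\<^sub>L 'h\<close> consists of the bounded real-linear maps, hence
  the carrier.\<close>

definition bop_alg :: "('h::chilbert_space \<Rightarrow>\<^sub>L 'h) cstar_alg" where
  "bop_alg = \<lparr>carrier = {T. \<forall>c x. blinfun_apply T (c *\<^sub>C x) = c *\<^sub>C blinfun_apply T x},
     monoid.mult = (o\<^sub>L), one = id_blinfun, zero = 0, add = (+),
     cscale = (\<lambda>c T. Blinfun (\<lambda>x. c *\<^sub>C blinfun_apply T x)),
     star = hadjoint, cnorm = norm\<rparr>"

definition partial_isometry :: "('h::chilbert_space \<Rightarrow>\<^sub>L 'h) \<Rightarrow> bool" where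
  "partial_isometry U \<longleftrightarrow> U \<in> carrier bop_alg \<and>
     (\<forall>x. (\<forall>y. blinfun_apply U y = 0 \<longrightarrow> cinner x y = 0) \<longrightarrow> norm (blinfun_apply U x) = norm x)"

definition commutant :: "('h::chilbert_space \<Rightarrow>\<^sub>L 'h) set \<Rightarrow> ('h \<Rightarrow>\<^sub>L 'h) set" where
  "commutant S = {T \<in> carrier bop_alg. \<forall>R\<in>S. T o\<^sub>L R = R o\<^sub>L T}"


section \<open>C*-dynamical systems and covariant representations\<close>

locale cstar_dynamical_system = cstar_algebra A
  for A :: "('a, 'm) cstar_alg_scheme" (structure) and \<delta> :: "'a \<Rightarrow> 'a" +
  assumes star_endo: "\<delta> \<in> star_hom A A"

text \<open>\<^const>\<open>span\<close> is the real span; the set of all vectors \<open>\<pi>(a)h\<close> is stable under complex scalars,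
  so here it is also the complex span.\<close>

locale covariant_representation = cstar_dynamical_system A \<delta>
  for A :: "('a, 'm) cstar_alg_scheme" (structure) and \<delta> :: "'a \<Rightarrow> 'a"
    and \<pi> :: "'a \<Rightarrow> ('h::chilbert_space \<Rightarrow>\<^sub>L 'h)" and U :: "'h \<Rightarrow>\<^sub>L 'h" +
  assumes representation: "\<pi> \<in> star_hom A bop_alg"
    and nondegenerate: "closure (span {blinfun_apply (\<pi> a) h | a h. a \<in> carrier A}) = UNIV"
    and faithful: "inj_on \<pi> (carrier A)"
    and partial_isometry: "partial_isometry U"
    and covariance: "a \<in> carrier A \<Longrightarrow> U o\<^sub>L \<pi> a o\<^sub>L U\<^sup>\<dagger> = \<pi> (\<delta> a)"
    and initial_projection_commutes: "U\<^sup>\<dagger> o\<^sub>L U \<in> commutant (\<pi> ` carrier A)"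

text \<open>The extension of \<open>(A, \<delta>)\<close> associated with an ideal \<open>J\<close> orthogonal to \<open>Ker \<delta>\<close>. Both unions in
  \<open>ext_endo\<close> range over the representatives of the first component only and, since \<open>\<delta>\<close> vanishes on
  \<open>Ker \<delta>\<close>, each consists of a single coset.\<close>

definition ext_alg ::
  "('a, 'm) cstar_alg_scheme \<Rightarrow> ('a \<Rightarrow> 'a) \<Rightarrow> 'a set \<Rightarrow> ('a set \<times> 'a set) cstar_alg" where
  "ext_alg A \<delta> J = cstar_sum (cstar_quotient A (a_kernel A A \<delta>)) (cstar_quotient A J)"

definition ext_endo :: "('a, 'm) cstar_alg_scheme \<Rightarrow> ('a \<Rightarrow> 'a) \<Rightarrow> 'a set \<Rightarrow>
    'a set \<times> 'a set \<Rightarrow> 'a set \<times> 'a set" where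
  "ext_endo A \<delta> J = (\<lambda>(X, Y).
     (\<Union>a\<in>X. a_kernel A A \<delta> +>\<^bsub>A\<^esub> \<delta> a, \<Union>a\<in>X. J +>\<^bsub>A\<^esub> \<delta> a))"

definition ext_embed :: "('a, 'm) cstar_alg_scheme \<Rightarrow> ('a \<Rightarrow> 'a) \<Rightarrow> 'a set \<Rightarrow> 'a \<Rightarrow> 'a set \<times> 'a set" where
  "ext_embed A \<delta> J a = (a_kernel A A \<delta> +>\<^bsub>A\<^esub> a, J +>\<^bsub>A\<^esub> a)"

definition extension_rep :: "('a, 'm) cstar_alg_scheme \<Rightarrow> ('a \<Rightarrow> 'a) \<Rightarrow>
    ('a \<Rightarrow> ('h::chilbert_space \<Rightarrow>\<^sub>L 'h)) \<Rightarrow> ('h \<Rightarrow>\<^sub>L 'h) \<Rightarrow> 'a set \<Rightarrow>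
    ('a set \<times> 'a set \<Rightarrow> ('h \<Rightarrow>\<^sub>L 'h)) \<Rightarrow> bool" where
  "extension_rep A \<delta> \<pi> U J \<rho> \<longleftrightarrow>
     (\<forall>a\<in>carrier A. \<rho> (ext_embed A \<delta> J a) = \<pi> a) \<and>
     \<rho> \<in> star_iso (ext_alg A \<delta> J) (cstar_generated bop_alg (\<pi> ` carrier A \<union> {U\<^sup>\<dagger> o\<^sub>L U})) \<and>
     covariant_representation (ext_alg A \<delta> J) (ext_endo A \<delta> J) \<rho> U"

end

theory Submission
  imports Defs
begin


text \<open>Write \<open>P\<close> for the projection \<open>U\<^sup>\<dagger>U\<close>, which commutes with \<open>\<pi>(A)\<close>, and \<open>P'\<close> for \<open>1 - P\<close>. Compression by
  either of them is a *-homomorphism on \<open>A\<close>, and \<open>I\<close> and \<open>J\<close> are the kernels of \<open>a \<mapsto> P \<pi>(a)\<close> and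
  \<open>a \<mapsto> P' \<pi>(a)\<close>. Since \<open>U T U\<^sup>\<dagger> = 0\<close> exactly when \<open>P T = 0\<close>, for \<open>T\<close> commuting with \<open>P\<close>, the first
  kernel is that of \<open>\<delta>\<close>; and \<open>\<pi>(a) = P \<pi>(a) + P' \<pi>(a)\<close> makes the kernels meet only in zero.
  Algebraically it is then clear that \<open>(a + I, b + J) \<mapsto> P \<pi>(a) + P' \<pi>(b)\<close> is a well defined injective
  unital *-homomorphism which intertwines \<open>\<delta>\<^sub>J\<close> with \<open>T \<mapsto> U T U\<^sup>\<dagger>\<close>.

  The analytic content is that this map is isometric with closed range. It makes the extension a
  C*-algebra, in particular it makes the quotient norms C*-norms, and it identifies the range with
  the C*-algebra generated by \<open>\<pi>(A)\<close> and \<open>P\<close>. Two facts are needed.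

  \<^item> A faithful representation is isometric. This is proved in the form: a complete C*-norm on a
    unital *-algebra of operators is the operator norm (\<open>N_eq_norm\<close>).

  \<^item> The quotient norm of \<open>a + ker\<close> is the norm of the compression of \<open>\<pi>(a)\<close>, that is, \<open>\<pi>(a)\<close> can be
    corrected by an element of the kernel so that its norm nearly drops to that of its compression
    (\<open>lift_norm\<close>). By summing such corrections the compressed algebra is closed
    (\<open>closed_compression\<close>).

  Both are proved with no spectral theory. For self-adjoint \<open>d\<close> the algebra contains an absolute value
  \<open>v = |d|\<close> that is the square of a self-adjoint \<open>t\<close>; it is built from the square root of \<open>1 - y\<close> for
  self-adjoint \<open>y\<close> of norm at most one, which is the limit of a fixed point iteration. If
  \<open>d = x\<^sup>\<dagger>x - s\<close> with \<open>s\<close> the squared norm of the compression of \<open>x\<close>, then \<open>d\<close> is negative on the range of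
  the projection, so there \<open>|d| = -d\<close>: the element \<open>e = v + d\<close> lies in the kernel, and
  \<open>x\<^sup>\<dagger>x = s + e - v \<le> s + e\<close>. For the trivial projection \<open>e\<close> vanishes and the first fact follows; in
  general \<open>e\<close> is damped by the inverse of \<open>1 + e\<^sup>2 / \<epsilon>\<^sup>2\<close>, which is \<open>1\<close> modulo the kernel.

  For uniqueness, an extension \<open>\<sigma>\<close> is determined by its value at the central projection \<open>(0, 1)\<close>. As
  \<open>\<delta>\<^sub>J\<close> kills that element, \<open>\<sigma>(0, 1) \<le> P'\<close>. As \<open>\<sigma>\<close> is onto, \<open>P' = \<sigma>(z)\<close> for some \<open>z\<close>, which \<open>\<delta>\<^sub>J\<close> kills as
  well; hence \<open>z\<close> has the form \<open>(0, y)\<close>, and \<open>P' \<le> \<sigma>(0, 1)\<close>.\<close>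

section \<open>Hilbert space operators\<close>

lemma cinner_add_right: "cinner x (y + z) = cinner x y + cinner (x::'h::chilbert_space) z"
  by (metis cinner_add_left cinner_commute complex_cnj_add)

lemma cinner_scaleC_right: "cinner x (c *\<^sub>C y) = cnj c * cinner (x::'h::chilbert_space) y"
  by (metis cinner_commute cinner_scaleC_left complex_cnj_mult)

lemma scaleC_minus_one: "(- 1) *\<^sub>C x = - (x::'h::chilbert_space)"
  by (metis of_real_1 of_real_minus scaleR_minus_left scaleR_one scaleR_scaleC)

lemma scaleC_zero_right [simp]: "c *\<^sub>C (0::'h::chilbert_space) = 0"
  by (metis add_cancel_right_right scaleC_add_right)

lemma scaleC_zero_left [simp]: "0 *\<^sub>C (x::'h::chilbert_space) = 0"
  by (metis of_real_0 scaleR_scaleC scaleR_zero_left)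

lemma scaleC_minus_right: "c *\<^sub>C (- x) = - (c *\<^sub>C (x::'h::chilbert_space))"
  by (metis add_eq_0_iff scaleC_add_right scaleC_zero_right)

lemma scaleC_diff_right: "c *\<^sub>C (x - y) = c *\<^sub>C x - c *\<^sub>C (y::'h::chilbert_space)"
  by (metis add_uminus_conv_diff scaleC_add_right scaleC_minus_right)

lemma cinner_minus_left: "cinner (- x) y = - cinner (x::'h::chilbert_space) y"
  by (metis cinner_scaleC_left mult_minus1 scaleC_minus_one)

lemma cinner_minus_right: "cinner x (- y) = - cinner (x::'h::chilbert_space) y"
  by (metis cinner_commute cinner_minus_left complex_cnj_minus)

lemma cinner_diff_left: "cinner (x - y) z = cinner x z - cinner (y::'h::chilbert_space) z"
  by (metis add_uminus_conv_diff cinner_add_left cinner_minus_left)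

lemma cinner_diff_right: "cinner x (y - z) = cinner x y - cinner (x::'h::chilbert_space) z"
  by (metis add_uminus_conv_diff cinner_add_right cinner_minus_right)

lemma cinner_zero_left [simp]: "cinner 0 (x::'h::chilbert_space) = 0"
  by (metis cinner_scaleC_left mult_zero_left scaleC_zero_left)

lemma cinner_zero_right [simp]: "cinner (x::'h::chilbert_space) 0 = 0"
  by (metis cinner_commute cinner_zero_left complex_cnj_zero)

lemma cinner_scaleR_left: "cinner (r *\<^sub>R x) y = of_real r * cinner (x::'h::chilbert_space) y"
  by (simp add: scaleR_scaleC cinner_scaleC_left)

lemma cinner_scaleR_right: "cinner x (r *\<^sub>R y) = of_real r * cinner (x::'h::chilbert_space) y"
  by (simp add: scaleR_scaleC cinner_scaleC_right)

lemmas cinner_simps = cinner_add_left cinner_add_right cinner_diff_left cinner_diff_right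
  cinner_scaleC_left cinner_scaleC_right cinner_scaleR_left cinner_scaleR_right
  cinner_minus_left cinner_minus_right

lemma cinner_self: "cinner x x = of_real ((norm (x::'h::chilbert_space))\<^sup>2)"
proof (rule complex_eqI)
  show "Re (cinner x x) = Re (of_real ((norm x)\<^sup>2))"
    by (simp add: norm_eq_sqrt_cinner cinner_ge_zero)
  have "Im (cinner x x) = - Im (cinner x x)"
    by (metis cinner_commute cnj.simps(2))
  thus "Im (cinner x x) = Im (of_real ((norm x)\<^sup>2))" by simp
qed

lemma cinner_ext:
  assumes "\<And>z. cinner z x = cinner z y"
  shows "x = (y::'h::chilbert_space)"
proof -
  have "cinner (x - y) (x - y) = 0" by (simp add: cinner_diff_right assms)
  thus ?thesis by (simp add: cinner_eq_zero)
qed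

lemma norm_scaleC: "norm (c *\<^sub>C x) = cmod c * norm (x::'h::chilbert_space)"
proof -
  have "complex_of_real ((norm (c *\<^sub>C x))\<^sup>2) = of_real ((cmod c * norm x)\<^sup>2)"
    unfolding cinner_self[symmetric]
    using complex_norm_square[of c]
    by (simp add: cinner_simps power_mult_distrib) (simp add: cinner_self flip: mult.assoc)
  hence "(norm (c *\<^sub>C x))\<^sup>2 = (cmod c * norm x)\<^sup>2"
    using of_real_eq_iff by blast
  thus ?thesis by (simp add: power2_eq_iff_nonneg)
qed

lemma norm_add_sq:
  "(norm (x + y))\<^sup>2 = (norm x)\<^sup>2 + (norm (y::'h::chilbert_space))\<^sup>2 + 2 * Re (cinner x y)"
proof -
  have "Re (cinner (x + y) (x + y)) = Re (cinner x x) + Re (cinner y y) + Re (cinner x y) + Re (cinner y x)"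
    by (simp add: cinner_simps)
  moreover have "Re (cinner y x) = Re (cinner x y)"
    by (metis cinner_commute cnj.simps(1))
  ultimately show ?thesis by (simp add: cinner_self)
qed

lemma norm_diff_sq:
  "(norm (x - y))\<^sup>2 = (norm x)\<^sup>2 + (norm (y::'h::chilbert_space))\<^sup>2 - 2 * Re (cinner x y)"
  using norm_add_sq[of x "- y"] by (simp add: cinner_minus_right)

text \<open>The subtracted vector is the orthogonal projection of \<open>x\<close> onto the line through \<open>y\<close>. The formula gives
  the Cauchy-Schwarz inequality and the orthogonality step in the Riesz representation theorem.\<close>

lemma norm_diff_projection_sq:
  fixes x y :: "'h::chilbert_space"
  assumes "y \<noteq> 0"
  shows "(norm (x - (cinner x y / of_real ((norm y)\<^sup>2)) *\<^sub>C y))\<^sup>2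
    = (norm x)\<^sup>2 - (cmod (cinner x y))\<^sup>2 / (norm y)\<^sup>2"
proof -
  define c where "c = cinner x y"
  define t where "t = c / of_real ((norm y)\<^sup>2)"
  have n: "norm y > 0" using assms by simp
  have t: "cmod t = cmod c / (norm y)\<^sup>2" by (simp add: t_def norm_divide norm_power)
  have "cnj t * c = (c * cnj c) / of_real ((norm y)\<^sup>2)" by (simp add: t_def)
  also have "c * cnj c = of_real ((cmod c)\<^sup>2)" by (rule complex_norm_square[symmetric])
  finally have tc: "cnj t * c = of_real ((cmod c)\<^sup>2 / (norm y)\<^sup>2)" by simp
  have "(norm (x - t *\<^sub>C y))\<^sup>2 = (norm x)\<^sup>2 + (cmod t * norm y)\<^sup>2 - 2 * Re (cnj t * c)"
    by (simp add: norm_diff_sq norm_scaleC cinner_scaleC_right c_def)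
  also have "(cmod t * norm y)\<^sup>2 = (cmod c)\<^sup>2 / (norm y)\<^sup>2"
    using n unfolding t by (simp add: field_simps power2_eq_square)
  finally show ?thesis unfolding tc by (simp add: c_def t_def)
qed

lemma cauchy_schwarz: "cmod (cinner x y) \<le> norm x * norm (y::'h::chilbert_space)"
proof (cases "y = 0")
  case False
  have "0 \<le> (norm x)\<^sup>2 - (cmod (cinner x y))\<^sup>2 / (norm y)\<^sup>2"
    unfolding norm_diff_projection_sq[OF False, symmetric] by simp
  hence "(cmod (cinner x y))\<^sup>2 \<le> (norm x * norm y)\<^sup>2"
    using False by (simp add: field_simps power_mult_distrib)
  thus ?thesis by (rule power2_le_imp_le) simp
qed simp

text \<open>The representing vector is a multiple of the shortest vector in the affine hyperplane on which
  the functional is one. By the parallelogram law a minimizing sequence in that hyperplane is Cauchy,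
  and minimality makes its limit orthogonal to the kernel.\<close>

lemma riesz_representation:
  fixes f :: "'h::chilbert_space \<Rightarrow> complex"
  assumes add: "\<And>x y. f (x + y) = f x + f y" and scale: "\<And>c x. f (c *\<^sub>C x) = c * f x"
    and bound: "\<And>x. cmod (f x) \<le> K * norm x"
  shows "\<exists>z. \<forall>x. f x = cinner x z"
proof (cases "\<forall>x. f x = 0")
  case True
  thus ?thesis by (intro exI[of _ 0]) simp
next
  case False
  then obtain x0 where x0: "f x0 \<noteq> 0" by blast
  have f_diff: "f (x - y) = f x - f y" for x y
    using add[of x "- y"] scale[of "- 1" y] by (simp add: scaleC_minus_one)
  have f_scaleR: "f (r *\<^sub>R x) = of_real r * f x" for r x
    by (simp add: scaleR_scaleC scale)
  define M where "M = {x. f x = 1}"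
  define d where "d = Inf (norm ` M)"
  have "(1 / f x0) *\<^sub>C x0 \<in> M" using x0 by (simp add: M_def scale)
  hence ne: "norm ` M \<noteq> {}" by blast
  have bdd: "bdd_below (norm ` M)" by (rule bdd_belowI[of _ 0]) auto
  have d_le: "d \<le> norm x" if "x \<in> M" for x
    unfolding d_def using bdd that by (simp add: cInf_lower)
  have d0: "d \<ge> 0" unfolding d_def using ne by (intro cInf_greatest) auto
  have "\<exists>z\<in>M. norm z < d + 1 / Suc n" for n
  proof -
    have "Inf (norm ` M) < d + 1 / Suc n" unfolding d_def by simp
    thus ?thesis using cInf_lessD[OF ne] by fastforce
  qed
  then obtain z where zM: "\<And>n. z n \<in> M" and zn: "\<And>n. norm (z n) < d + 1 / Suc n" by metis
  have zsq: "(norm (z n))\<^sup>2 \<le> (d + 1 / Suc n)\<^sup>2" for n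
    using zn[of n] by (intro power_mono) auto
  have sqlim: "(\<lambda>n. (d + 1 / Suc n)\<^sup>2) \<longlonglongrightarrow> d\<^sup>2"
    using tendsto_power[OF tendsto_add[OF tendsto_const[of d] LIMSEQ_Suc[OF lim_1_over_n]], of 2] by simp
  \<comment> \<open>parallelogram law; the midpoint of two points of the hyperplane lies in it\<close>
  have par: "(norm (z m - z n))\<^sup>2 \<le> 2 * (d + 1 / Suc m)\<^sup>2 + 2 * (d + 1 / Suc n)\<^sup>2 - 4 * d\<^sup>2" for m n
  proof -
    have "(1/2) *\<^sub>R (z m + z n) \<in> M" using zM[of m] zM[of n] by (simp add: M_def add f_scaleR)
    from d_le[OF this] have "2 * d \<le> norm (z m + z n)" by simp
    hence "(2 * d)\<^sup>2 \<le> (norm (z m + z n))\<^sup>2" using d0 by (intro power_mono) auto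
    moreover have "(norm (z m - z n))\<^sup>2 + (norm (z m + z n))\<^sup>2 = 2 * (norm (z m))\<^sup>2 + 2 * (norm (z n))\<^sup>2"
      by (simp add: norm_add_sq norm_diff_sq)
    ultimately show ?thesis using zsq[of m] zsq[of n] by (simp add: power_mult_distrib)
  qed
  have "Cauchy z"
  proof (rule metric_CauchyI)
    fix e :: real assume e: "e > 0"
    have "\<forall>\<^sub>F n in sequentially. (d + 1 / Suc n)\<^sup>2 < d\<^sup>2 + e\<^sup>2 / 4"
      using e by (intro order_tendstoD(2)[OF sqlim]) simp
    then obtain N where N: "\<And>n. n \<ge> N \<Longrightarrow> (d + 1 / Suc n)\<^sup>2 < d\<^sup>2 + e\<^sup>2 / 4"
      by (auto simp: eventually_sequentially)
    have "dist (z m) (z n) < e" if "m \<ge> N" "n \<ge> N" for m n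
    proof -
      have "(norm (z m - z n))\<^sup>2 < e\<^sup>2"
        using par[of m n] N[OF that(1)] N[OF that(2)] by linarith
      thus ?thesis using e by (simp add: dist_norm power2_less_imp_less)
    qed
    thus "\<exists>N. \<forall>m\<ge>N. \<forall>n\<ge>N. dist (z m) (z n) < e" by blast
  qed
  then obtain w where w: "z \<longlonglongrightarrow> w" using Cauchy_convergent convergent_def by blast
  have "(\<lambda>n. f (z n - w)) \<longlonglongrightarrow> 0"
  proof (rule Lim_null_comparison)
    show "\<forall>\<^sub>F n in sequentially. norm (f (z n - w)) \<le> K * norm (z n - w)" using bound by simp
    have "(\<lambda>n. norm (z n - w)) \<longlonglongrightarrow> 0" using w by (simp add: LIM_zero tendsto_norm_zero)
    thus "(\<lambda>n. K * norm (z n - w)) \<longlonglongrightarrow> 0" using tendsto_mult_right_zero by blast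
  qed
  hence "(\<lambda>n. 1 - f w) \<longlonglongrightarrow> 0" using zM by (simp add: f_diff M_def)
  hence fw: "f w = 1" by (simp add: LIMSEQ_const_iff)
  have "norm w \<le> d"
  proof (rule LIMSEQ_le[OF tendsto_norm[OF w]])
    show "(\<lambda>n. d + 1 / Suc n) \<longlonglongrightarrow> d"
      using tendsto_add[OF tendsto_const[of d] LIMSEQ_Suc[OF lim_1_over_n]] by simp
    show "\<exists>N. \<forall>n\<ge>N. norm (z n) \<le> d + 1 / Suc n" using less_imp_le[OF zn] by blast
  qed
  hence min: "norm w \<le> norm x" if "f x = 1" for x using d_le[of x] that by (simp add: M_def)
  have w0: "w \<noteq> 0" using fw scale[of 0 w] by auto
  have orth: "cinner x w = 0" if x: "f x = 0" for x
  proof (cases "x = 0")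
    case False
    have "norm w \<le> norm (w - (cinner w x / of_real ((norm x)\<^sup>2)) *\<^sub>C x)"
      by (rule min) (simp add: f_diff scale x fw)
    hence "(norm w)\<^sup>2 \<le> (norm (w - (cinner w x / of_real ((norm x)\<^sup>2)) *\<^sub>C x))\<^sup>2"
      by (intro power_mono) auto
    hence "(cmod (cinner w x))\<^sup>2 / (norm x)\<^sup>2 \<le> 0"
      unfolding norm_diff_projection_sq[OF False] by simp
    hence "cinner w x = 0" using False by (simp add: divide_le_0_iff)
    thus ?thesis by (metis cinner_commute complex_cnj_zero)
  qed simp
  show ?thesis
  proof (intro exI allI)
    fix x
    have "f (x - f x *\<^sub>C w) = 0" by (simp add: f_diff scale fw)
    from orth[OF this] have "cinner x w = f x * of_real ((norm w)\<^sup>2)"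
      by (simp add: cinner_diff_left cinner_scaleC_left cinner_self)
    thus "f x = cinner x ((1 / (norm w)\<^sup>2) *\<^sub>R w)" using w0 by (simp add: cinner_scaleR_right)
  qed
qed

lemma carrier_bop: "T \<in> carrier bop_alg \<longleftrightarrow> (\<forall>c x. blinfun_apply T (c *\<^sub>C x) = c *\<^sub>C blinfun_apply T x)"
  by (simp add: bop_alg_def)

lemma hadjoint_exists:
  fixes T :: "'h::chilbert_space \<Rightarrow>\<^sub>L 'h"
  assumes T: "T \<in> carrier bop_alg"
  shows "\<exists>S. \<forall>x y. cinner (blinfun_apply T x) y = cinner x (blinfun_apply S y)"
proof -
  have "\<exists>z. \<forall>x. cinner (blinfun_apply T x) y = cinner x z" for y
  proof (rule riesz_representation)
    fix x
    have "cmod (cinner (blinfun_apply T x) y) \<le> norm (blinfun_apply T x) * norm y" by (rule cauchy_schwarz)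
    also have "\<dots> \<le> norm T * norm x * norm y" by (simp add: mult_right_mono norm_blinfun)
    finally show "cmod (cinner (blinfun_apply T x) y) \<le> (norm T * norm y) * norm x" by (simp add: mult_ac)
  qed (use T in \<open>auto simp: carrier_bop blinfun.bilinear_simps cinner_simps\<close>)
  then obtain g where g: "\<And>x y. cinner (blinfun_apply T x) y = cinner x (g y)" by metis
  have "bounded_linear g"
  proof (rule bounded_linear_intro)
    show "g (x + y) = g x + g y" for x y
      by (rule cinner_ext) (simp add: g[symmetric] cinner_simps)
    show "g (r *\<^sub>R x) = r *\<^sub>R g x" for r x
      by (rule cinner_ext) (simp add: g[symmetric] cinner_simps)
    show "norm (g y) \<le> norm y * norm T" for y
    proof (cases "g y = 0")
      case False
      have "(norm (g y))\<^sup>2 = cmod (cinner (g y) (g y))" by (simp add: cinner_self norm_power)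
      also have "\<dots> = cmod (cinner (blinfun_apply T (g y)) y)" by (simp add: g)
      also have "\<dots> \<le> norm (blinfun_apply T (g y)) * norm y" by (rule cauchy_schwarz)
      also have "\<dots> \<le> norm T * norm (g y) * norm y" by (simp add: mult_right_mono norm_blinfun)
      finally show ?thesis using False by (simp add: power2_eq_square mult_ac)
    qed simp
  qed
  thus ?thesis using g by (intro exI[of _ "Blinfun g"]) (simp add: bounded_linear_Blinfun_apply)
qed

lemma hadjoint_unique:
  assumes "\<And>x y. cinner (blinfun_apply T x) y = cinner x (blinfun_apply S y)"
  shows "T\<^sup>\<dagger> = S"
  unfolding hadjoint_def
proof (rule the_equality)
  show "\<forall>x y. cinner (blinfun_apply T x) y = cinner x (blinfun_apply S y)" using assms by simp
  show "S' = S" if "\<forall>x y. cinner (blinfun_apply T x) y = cinner x (blinfun_apply S' y)" for S'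
    by (rule blinfun_eqI, rule cinner_ext) (metis assms that)
qed

lemma cinner_hadjoint_right:
  assumes "T \<in> carrier bop_alg"
  shows "cinner x (blinfun_apply (T\<^sup>\<dagger>) y) = cinner (blinfun_apply T x) y"
  using hadjoint_exists[OF assms] hadjoint_unique by metis

lemma cinner_hadjoint_left:
  assumes "T \<in> carrier bop_alg"
  shows "cinner (blinfun_apply (T\<^sup>\<dagger>) x) y = cinner x (blinfun_apply T y)"
  by (metis assms cinner_commute cinner_hadjoint_right)

lemma blinfun_apply_cscale: "blinfun_apply (cscale bop_alg c T) x = c *\<^sub>C blinfun_apply T x"
proof -
  have "bounded_linear (\<lambda>x. c *\<^sub>C blinfun_apply T x)"
  proof (rule bounded_linear_intro)
    show "norm (c *\<^sub>C blinfun_apply T x) \<le> norm x * (cmod c * norm T)" for x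
      using mult_left_mono[OF norm_blinfun[of T x], of "cmod c"] by (simp add: norm_scaleC mult_ac)
    show "c *\<^sub>C blinfun_apply T (r *\<^sub>R x) = r *\<^sub>R c *\<^sub>C blinfun_apply T x" for r x
      by (simp only: blinfun.scaleR_right) (simp add: scaleR_scaleC scaleC_scaleC mult.commute)
  qed (simp add: blinfun.bilinear_simps scaleC_add_right)
  thus ?thesis by (simp add: bop_alg_def bounded_linear_Blinfun_apply)
qed

lemma bop_simps [simp]:
  "mult bop_alg = (o\<^sub>L)" "one bop_alg = id_blinfun" "zero bop_alg = 0" "add bop_alg = (+)"
  "star bop_alg = hadjoint" "cnorm bop_alg = norm"
  by (simp_all add: bop_alg_def)

lemma cscale_of_real: "cscale bop_alg (of_real r) T = r *\<^sub>R T"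
  by (rule blinfun_eqI) (simp add: blinfun_apply_cscale scaleR_scaleC blinfun.bilinear_simps)

lemma bop_closed [simp, intro]:
  "id_blinfun \<in> carrier bop_alg" "0 \<in> carrier bop_alg"
  "T \<in> carrier bop_alg \<Longrightarrow> T' \<in> carrier bop_alg \<Longrightarrow> T + T' \<in> carrier bop_alg"
  "T \<in> carrier bop_alg \<Longrightarrow> T' \<in> carrier bop_alg \<Longrightarrow> T - T' \<in> carrier bop_alg"
  "T \<in> carrier bop_alg \<Longrightarrow> T' \<in> carrier bop_alg \<Longrightarrow> T o\<^sub>L T' \<in> carrier bop_alg"
  "T \<in> carrier bop_alg \<Longrightarrow> cscale bop_alg c T \<in> carrier bop_alg"
  "T \<in> carrier bop_alg \<Longrightarrow> r *\<^sub>R T \<in> carrier bop_alg"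
  by (simp_all add: carrier_bop blinfun.bilinear_simps scaleC_add_right scaleC_diff_right
      blinfun_apply_cscale scaleC_scaleC mult.commute scaleR_scaleC)

lemma hadjoint_closed [simp, intro]:
  assumes "T \<in> carrier bop_alg"
  shows "T\<^sup>\<dagger> \<in> carrier bop_alg"
  unfolding carrier_bop
  by (intro allI, rule cinner_ext) (simp add: cinner_hadjoint_right[OF assms] cinner_simps)

lemma hadjoint_hadjoint [simp]: "T \<in> carrier bop_alg \<Longrightarrow> (T\<^sup>\<dagger>)\<^sup>\<dagger> = T"
  by (rule hadjoint_unique) (simp add: cinner_hadjoint_left)

lemma hadjoint_id [simp]: "id_blinfun\<^sup>\<dagger> = id_blinfun"
  by (rule hadjoint_unique) simp

lemma hadjoint_zero [simp]: "0\<^sup>\<dagger> = 0"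
  by (rule hadjoint_unique) simp

lemma hadjoint_add:
  "T \<in> carrier bop_alg \<Longrightarrow> T' \<in> carrier bop_alg \<Longrightarrow> (T + T')\<^sup>\<dagger> = T\<^sup>\<dagger> + T'\<^sup>\<dagger>"
  by (rule hadjoint_unique) (simp add: cinner_hadjoint_right blinfun.bilinear_simps cinner_simps)

lemma hadjoint_diff:
  "T \<in> carrier bop_alg \<Longrightarrow> T' \<in> carrier bop_alg \<Longrightarrow> (T - T')\<^sup>\<dagger> = T\<^sup>\<dagger> - T'\<^sup>\<dagger>"
  by (rule hadjoint_unique) (simp add: cinner_hadjoint_right blinfun.bilinear_simps cinner_simps)

lemma hadjoint_compose:
  "T \<in> carrier bop_alg \<Longrightarrow> T' \<in> carrier bop_alg \<Longrightarrow> (T o\<^sub>L T')\<^sup>\<dagger> = T'\<^sup>\<dagger> o\<^sub>L T\<^sup>\<dagger>"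
  by (rule hadjoint_unique) (simp add: cinner_hadjoint_right)

lemma hadjoint_cscale:
  "T \<in> carrier bop_alg \<Longrightarrow> (cscale bop_alg c T)\<^sup>\<dagger> = cscale bop_alg (cnj c) (T\<^sup>\<dagger>)"
  by (rule hadjoint_unique) (simp add: cinner_hadjoint_right blinfun_apply_cscale cinner_simps)

lemma hadjoint_scaleR: "T \<in> carrier bop_alg \<Longrightarrow> (r *\<^sub>R T)\<^sup>\<dagger> = r *\<^sub>R T\<^sup>\<dagger>"
  by (metis cscale_of_real hadjoint_cscale complex_cnj_complex_of_real)

lemmas hadjoint_simps = hadjoint_add hadjoint_diff hadjoint_compose hadjoint_cscale hadjoint_scaleR

lemma norm_bop_cscale: "norm (cscale bop_alg c T) = cmod c * norm T"
proof (rule antisym)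
  have le: "norm (cscale bop_alg c T) \<le> cmod c * norm T" for c and T :: "'a::chilbert_space \<Rightarrow>\<^sub>L 'a"
    using norm_blinfun[of T] by (intro norm_blinfun_bound)
      (simp_all add: blinfun_apply_cscale norm_scaleC mult_left_mono mult.assoc)
  show "norm (cscale bop_alg c T) \<le> cmod c * norm T" by (rule le)
  show "cmod c * norm T \<le> norm (cscale bop_alg c T)"
  proof (cases "c = 0")
    case False
    have "T = cscale bop_alg (1 / c) (cscale bop_alg c T)"
      using False by (intro blinfun_eqI) (simp add: blinfun_apply_cscale scaleC_scaleC scaleC_one)
    hence "norm T \<le> cmod (1 / c) * norm (cscale bop_alg c T)" using le by metis
    thus ?thesis using False by (simp add: norm_divide divide_simps mult.commute)
  qed simp
qed

lemma norm_hadjoint_compose: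
  assumes T: "T \<in> carrier bop_alg"
  shows "norm (T\<^sup>\<dagger> o\<^sub>L T) = (norm T)\<^sup>2"
proof -
  have sq: "(norm S)\<^sup>2 \<le> norm (S\<^sup>\<dagger> o\<^sub>L S)" if S: "S \<in> carrier bop_alg" for S :: "'a \<Rightarrow>\<^sub>L 'a"
  proof -
    have "norm (blinfun_apply S x) \<le> sqrt (norm (S\<^sup>\<dagger> o\<^sub>L S)) * norm x" for x
    proof (rule power2_le_imp_le)
      have "(norm (blinfun_apply S x))\<^sup>2 = cmod (cinner x (blinfun_apply (S\<^sup>\<dagger> o\<^sub>L S) x))"
        by (simp add: cinner_hadjoint_right[OF S] cinner_self norm_power)
      also have "\<dots> \<le> norm x * norm (blinfun_apply (S\<^sup>\<dagger> o\<^sub>L S) x)" by (rule cauchy_schwarz)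
      also have "\<dots> \<le> norm x * (norm (S\<^sup>\<dagger> o\<^sub>L S) * norm x)"
        by (intro mult_left_mono norm_blinfun) simp
      finally show "(norm (blinfun_apply S x))\<^sup>2 \<le> (sqrt (norm (S\<^sup>\<dagger> o\<^sub>L S)) * norm x)\<^sup>2"
        by (simp add: power_mult_distrib power2_eq_square mult_ac)
    qed simp
    hence "norm S \<le> sqrt (norm (S\<^sup>\<dagger> o\<^sub>L S))" by (intro norm_blinfun_bound) auto
    hence "(norm S)\<^sup>2 \<le> (sqrt (norm (S\<^sup>\<dagger> o\<^sub>L S)))\<^sup>2" by (rule power_mono) simp
    thus ?thesis by simp
  qed
  have adj: "norm S \<le> norm (S\<^sup>\<dagger>)" if "S \<in> carrier bop_alg" for S :: "'a \<Rightarrow>\<^sub>L 'a"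
  proof (cases "S = 0")
    case False
    have "(norm S)\<^sup>2 \<le> norm (S\<^sup>\<dagger>) * norm S"
      using sq[OF that] norm_blinfun_compose order_trans by blast
    thus ?thesis using False by (simp add: power2_eq_square)
  qed simp
  have "norm (T\<^sup>\<dagger>) = norm T" using adj[OF T] adj[of "T\<^sup>\<dagger>"] T by simp
  thus ?thesis using sq[OF T] norm_blinfun_compose[of "T\<^sup>\<dagger>" T] by (simp add: power2_eq_square)
qed

lemma blinfun_compose_assoc: "(a o\<^sub>L b) o\<^sub>L c = a o\<^sub>L (b o\<^sub>L c)"
  by (rule blinfun_eqI) simp



section \<open>Complete C*-norms on algebras of operators\<close>

text \<open>The infix symbol of \<^const>\<open>blinfun_compose\<close> binds more weakly than addition; the following one
  binds like a product.\<close>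

notation blinfun_compose (infixl \<open>\<star>\<close> 70)

lemma blinfun_compose_id [simp]: "id_blinfun \<star> T = T" "T \<star> id_blinfun = T"
  by (rule blinfun_eqI, simp)+

locale operator_star_algebra =
  fixes S :: "('h::chilbert_space \<Rightarrow>\<^sub>L 'h) set"
  assumes subset_bop: "S \<subseteq> carrier bop_alg"
    and id_mem [simp, intro]: "id_blinfun \<in> S"
    and add_mem [simp, intro]: "x \<in> S \<Longrightarrow> y \<in> S \<Longrightarrow> x + y \<in> S"
    and compose_mem [simp, intro]: "x \<in> S \<Longrightarrow> y \<in> S \<Longrightarrow> x \<star> y \<in> S"
    and cscale_mem [simp, intro]: "x \<in> S \<Longrightarrow> cscale bop_alg c x \<in> S"
    and hadjoint_mem [simp, intro]: "x \<in> S \<Longrightarrow> x\<^sup>\<dagger> \<in> S"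
begin

lemma mem_bop [simp, intro]: "x \<in> S \<Longrightarrow> x \<in> carrier bop_alg"
  using subset_bop by blast

lemma scaleR_mem [simp, intro]: "x \<in> S \<Longrightarrow> r *\<^sub>R x \<in> S"
  by (metis cscale_of_real cscale_mem)

lemma minus_mem [simp, intro]: "x \<in> S \<Longrightarrow> - x \<in> S"
  using scaleR_mem[of x "- 1"] by simp

lemma diff_mem [simp, intro]: "x \<in> S \<Longrightarrow> y \<in> S \<Longrightarrow> x - y \<in> S"
  using add_mem[of x "- y"] by simp

lemma zero_mem [simp, intro]: "0 \<in> S"
  using diff_mem[OF id_mem id_mem] by simp

end

text \<open>Norms and operations of an abstract C*-algebra are studied on its image under a faithful
  representation. There identities between operators can be checked on vectors, while the norm is still
  the abstract one and need not be known to agree with the operator norm.\<close>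

locale complete_cstar_norm = operator_star_algebra S
  for S :: "('h::chilbert_space \<Rightarrow>\<^sub>L 'h) set" +
  fixes N :: "('h \<Rightarrow>\<^sub>L 'h) \<Rightarrow> real"
  assumes N_ge_zero: "x \<in> S \<Longrightarrow> 0 \<le> N x"
    and N_eq_zero: "x \<in> S \<Longrightarrow> N x = 0 \<longleftrightarrow> x = 0"
    and N_triangle: "x \<in> S \<Longrightarrow> y \<in> S \<Longrightarrow> N (x + y) \<le> N x + N y"
    and N_cscale: "x \<in> S \<Longrightarrow> N (cscale bop_alg c x) = cmod c * N x"
    and N_compose: "x \<in> S \<Longrightarrow> y \<in> S \<Longrightarrow> N (x \<star> y) \<le> N x * N y"
    and N_cstar: "x \<in> S \<Longrightarrow> N (x\<^sup>\<dagger> \<star> x) = (N x)\<^sup>2"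
    and N_complete: "range s \<subseteq> S \<Longrightarrow> \<forall>e>0. \<exists>M. \<forall>m\<ge>M. \<forall>n\<ge>M. N (s m - s n) < e \<Longrightarrow>
      \<exists>x\<in>S. (\<lambda>n. N (s n - x)) \<longlonglongrightarrow> 0"
begin

lemma N_scaleR: "x \<in> S \<Longrightarrow> N (r *\<^sub>R x) = \<bar>r\<bar> * N x"
  by (metis N_cscale cscale_of_real norm_of_real)

lemma N_minus_commute: "x \<in> S \<Longrightarrow> y \<in> S \<Longrightarrow> N (x - y) = N (y - x)"
  using N_scaleR[of "y - x" "- 1"] by simp

lemma N_diff_le: "x \<in> S \<Longrightarrow> y \<in> S \<Longrightarrow> N (x - y) \<le> N x + N y"
  using N_triangle[of x "(- 1) *\<^sub>R y"] N_scaleR[of y "- 1"] by simp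

lemma N_hadjoint: "x \<in> S \<Longrightarrow> N (x\<^sup>\<dagger>) = N x"
proof -
  have le: "N x \<le> N (x\<^sup>\<dagger>)" if "x \<in> S" for x
  proof (cases "N x = 0")
    case True
    thus ?thesis using N_ge_zero[of "x\<^sup>\<dagger>"] that by simp
  next
    case False
    have "(N x)\<^sup>2 \<le> N (x\<^sup>\<dagger>) * N x" using N_compose[of "x\<^sup>\<dagger>" x] N_cstar that by simp
    thus ?thesis using False N_ge_zero[OF that] by (simp add: power2_eq_square)
  qed
  show "N (x\<^sup>\<dagger>) = N x" if "x \<in> S" using le[OF that] le[of "x\<^sup>\<dagger>"] that by simp
qed

lemma N_id_le: "N id_blinfun \<le> 1"
proof -
  have "N id_blinfun * N id_blinfun = N id_blinfun"
    using N_cstar[OF id_mem] by (simp add: power2_eq_square)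
  thus ?thesis by (cases "N id_blinfun = 0") simp_all
qed

lemma eq_zero_if_N_squeezed:
  assumes "x \<in> S" "\<And>n. N x \<le> u n" "u \<longlonglongrightarrow> 0"
  shows "x = 0"
proof -
  have "N x \<le> 0" using LIMSEQ_le_const[OF assms(3)] assms(2) by blast
  thus ?thesis using N_ge_zero[OF assms(1)] N_eq_zero[OF assms(1)] by simp
qed

text \<open>The iterations below converge because their increments are dominated by those of a bounded real
  sequence.\<close>

lemma majorized_limit:
  assumes p: "\<And>n. p n \<in> S" and step: "\<And>n. N (p (Suc n) - p n) \<le> r (Suc n) - r n"
    and bound: "\<And>n. r n \<le> b"
  obtains x where "x \<in> S" "(\<lambda>n. N (p n - x)) \<longlonglongrightarrow> 0"
proof -
  have mono: "incseq r"
  proof (rule incseq_SucI)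
    show "r n \<le> r (Suc n)" for n using step[of n] N_ge_zero[of "p (Suc n) - p n"] p by simp
  qed
  have dist: "N (p m - p n) \<le> r m - r n" if "n \<le> m" for m n
    using that
  proof (induction m rule: dec_induct)
    case base
    show ?case using N_eq_zero[OF zero_mem] by simp
  next
    case (step m)
    have "N (p (Suc m) - p n) \<le> N (p (Suc m) - p m) + N (p m - p n)"
      using N_triangle[of "p (Suc m) - p m" "p m - p n"] p by simp
    thus ?case using step assms(2)[of m] by simp
  qed
  have "Cauchy r"
    using incseq_convergent[OF mono] bound convergent_Cauchy convergentI by metis
  have "\<exists>x\<in>S. (\<lambda>n. N (p n - x)) \<longlonglongrightarrow> 0"
  proof (rule N_complete)
    show "range p \<subseteq> S" using p by blast
    show "\<forall>e>0. \<exists>M. \<forall>m\<ge>M. \<forall>n\<ge>M. N (p m - p n) < e"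
    proof (intro allI impI)
      fix e :: real assume "e > 0"
      then obtain M where M: "\<And>m n. m \<ge> M \<Longrightarrow> n \<ge> M \<Longrightarrow> \<bar>r m - r n\<bar> < e"
        using \<open>Cauchy r\<close> unfolding Cauchy_def dist_real_def by blast
      have "N (p m - p n) < e" if "m \<ge> M" "n \<ge> M" for m n
      proof (cases "n \<le> m")
        case True
        thus ?thesis using dist[OF True] M[OF that] by simp
      next
        case False
        thus ?thesis using dist[of m n] M[OF that] N_minus_commute[of "p m" "p n"] p by simp
      qed
      thus "\<exists>M. \<forall>m\<ge>M. \<forall>n\<ge>M. N (p m - p n) < e" by blast
    qed
  qed
  thus ?thesis using that by blast
qed

text \<open>The power series of \<open>1 - \<surd>(1 - y)\<close> has nonnegative coefficients with sum one, hence converges for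
  \<open>N y \<le> 1\<close>. Equivalently, and without series: the iteration \<open>x \<mapsto> (y + x\<^sup>2) / 2\<close> started at zero is
  majorized by the scalar iteration for \<open>y = 1\<close>, which increases and stays below one; a fixed point
  satisfies \<open>(1 - x)\<^sup>2 = 1 - y\<close>. Including \<open>N y = 1\<close> is essential for exact absolute values.\<close>

lemma sqrt_exists:
  assumes y: "y \<in> S" "y\<^sup>\<dagger> = y" "N y \<le> 1"
  obtains x where "x \<in> S" "x\<^sup>\<dagger> = x" "N x \<le> 1"
    "(id_blinfun - x) \<star> (id_blinfun - x) = id_blinfun - y"
    "\<And>c. c \<in> S \<Longrightarrow> c \<star> y = y \<star> c \<Longrightarrow> c \<star> x = x \<star> c"
proof -
  define p where "p = rec_nat 0 (\<lambda>_ q. (1/2) *\<^sub>R (y + q \<star> q))"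
  define r :: "nat \<Rightarrow> real" where "r = rec_nat 0 (\<lambda>_ q. (1 + q\<^sup>2) / 2)"
  have p0: "p 0 = 0" and pS: "p (Suc n) = (1/2) *\<^sub>R (y + p n \<star> p n)" for n
    by (simp_all add: p_def)
  have r0: "r 0 = 0" and rS: "r (Suc n) = (1 + (r n)\<^sup>2) / 2" for n
    by (simp_all add: r_def)
  have p: "p n \<in> S" for n by (induction n) (simp_all add: p0 pS y)
  have padj: "(p n)\<^sup>\<dagger> = p n" for n
    by (induction n) (simp_all add: p0 pS y p hadjoint_simps)
  have r_range: "0 \<le> r n \<and> r n \<le> 1" for n
  proof (induction n)
    case (Suc n)
    hence "(r n)\<^sup>2 \<le> 1" by (simp add: power_le_one)
    thus ?case by (simp add: rS)
  qed (simp add: r0)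
  have pr: "N (p n) \<le> r n" for n
  proof (induction n)
    case 0
    show ?case using N_eq_zero[OF zero_mem] by (simp add: p0 r0)
  next
    case (Suc n)
    have "N (p (Suc n)) \<le> (1/2) * (N y + N (p n \<star> p n))"
      using N_triangle[of y "p n \<star> p n"] y p by (simp add: pS N_scaleR)
    moreover have "N (p n \<star> p n) \<le> N (p n) * N (p n)" using N_compose p by simp
    moreover have "N (p n) * N (p n) \<le> r n * r n"
      using Suc N_ge_zero[OF p] r_range by (intro mult_mono) auto
    ultimately show ?case using y(3) by (simp add: rS power2_eq_square)
  qed
  have sq_diff: "N (a \<star> a - b \<star> b) \<le> (N a + N b) * N (a - b)" if "a \<in> S" "b \<in> S" for a b
  proof -
    have "a \<star> a - b \<star> b = a \<star> (a - b) + (a - b) \<star> b"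
      by (rule blinfun_eqI) (simp add: blinfun.bilinear_simps)
    thus ?thesis
      using N_triangle[of "a \<star> (a - b)" "(a - b) \<star> b"] N_compose[of a "a - b"] N_compose[of "a - b" b] that
      by (simp add: algebra_simps)
  qed
  have step_diff: "p (Suc n) - (1/2) *\<^sub>R (y + b \<star> b) = (1/2) *\<^sub>R (p n \<star> p n - b \<star> b)" for n b
    by (simp add: pS algebra_simps)
  have step: "N (p (Suc n) - p n) \<le> r (Suc n) - r n" for n
  proof (induction n)
    case 0
    show ?case using y by (simp add: pS p0 rS r0 N_scaleR)
  next
    case (Suc n)
    have "N (p (Suc (Suc n)) - p (Suc n)) = (1/2) * N (p (Suc n) \<star> p (Suc n) - p n \<star> p n)"
      using p by (simp add: step_diff[of "Suc n" "p n", folded pS] N_scaleR)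
    also have "\<dots> \<le> (1/2) * ((N (p (Suc n)) + N (p n)) * N (p (Suc n) - p n))"
      using sq_diff p by simp
    also have "\<dots> \<le> (1/2) * ((r (Suc n) + r n) * (r (Suc n) - r n))"
      using pr Suc N_ge_zero p r_range by (intro mult_left_mono mult_mono add_mono add_nonneg_nonneg) auto
    also have "\<dots> = r (Suc (Suc n)) - r (Suc n)"
      by (simp add: rS power2_eq_square field_simps)
    finally show ?case .
  qed
  obtain x where x: "x \<in> S" and lim: "(\<lambda>n. N (p n - x)) \<longlonglongrightarrow> 0"
    using majorized_limit[of p r 1, OF p step] r_range by blast
  have p1: "N (p n) \<le> 1" for n using pr[of n] r_range[of n] by simp
  have x1: "N x \<le> 1"
  proof (rule LIMSEQ_le_const)
    show "(\<lambda>n. 1 + N (p n - x)) \<longlonglongrightarrow> 1" using tendsto_add[OF tendsto_const[of 1] lim] by simp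
    have "N x \<le> 1 + N (p n - x)" for n
      using N_diff_le[of "p n" "p n - x"] p x p1[of n] by simp
    thus "\<exists>M. \<forall>n\<ge>M. N x \<le> 1 + N (p n - x)" by blast
  qed
  have xadj: "x\<^sup>\<dagger> = x"
  proof -
    have "N (x\<^sup>\<dagger> - x) \<le> 2 * N (p n - x)" for n
    proof -
      have "N (x\<^sup>\<dagger> - p n) = N (p n - x)"
        using N_hadjoint[of "x - p n"] N_minus_commute[OF x p] x p by (simp add: hadjoint_diff padj)
      thus ?thesis using N_triangle[of "x\<^sup>\<dagger> - p n" "p n - x"] x p by simp
    qed
    hence "x\<^sup>\<dagger> - x = 0"
      by (intro eq_zero_if_N_squeezed[OF _ _ tendsto_mult_right_zero[OF lim]]) (simp_all add: x)
    thus ?thesis by simp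
  qed
  have xeq: "x = (1/2) *\<^sub>R (y + x \<star> x)"
  proof -
    have "N (x - (1/2) *\<^sub>R (y + x \<star> x)) \<le> N (p (Suc n) - x) + N (p n - x)" for n
    proof -
      have "N (p (Suc n) - (1/2) *\<^sub>R (y + x \<star> x)) \<le> (1/2) * ((N (p n) + N x) * N (p n - x))"
        unfolding step_diff using sq_diff[of "p n" x] p x by (simp add: N_scaleR)
      also have "\<dots> \<le> (1/2) * (2 * N (p n - x))"
        using p1[of n] x1 N_ge_zero[of "p n - x"] p x by (intro mult_left_mono mult_right_mono) auto
      finally show ?thesis
        using N_triangle[of "x - p (Suc n)" "p (Suc n) - (1/2) *\<^sub>R (y + x \<star> x)"]
          N_minus_commute[OF x p] p x y by simp
    qed
    moreover have "(\<lambda>n. N (p (Suc n) - x) + N (p n - x)) \<longlonglongrightarrow> 0"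
      using tendsto_add[OF LIMSEQ_Suc[OF lim] lim] by simp
    ultimately have "x - (1/2) *\<^sub>R (y + x \<star> x) = 0"
      by (intro eq_zero_if_N_squeezed) (auto simp: x y)
    thus ?thesis by simp
  qed
  have sqrt: "(id_blinfun - x) \<star> (id_blinfun - x) = id_blinfun - y"
  proof (rule blinfun_eqI)
    fix v
    have "2 *\<^sub>R x = y + x \<star> x" by (subst xeq) simp
    hence "blinfun_apply (2 *\<^sub>R x) v = blinfun_apply (y + x \<star> x) v" by simp
    hence "blinfun_apply x (blinfun_apply x v) = 2 *\<^sub>R blinfun_apply x v - blinfun_apply y v"
      by (simp add: blinfun.bilinear_simps)
    thus "blinfun_apply ((id_blinfun - x) \<star> (id_blinfun - x)) v = blinfun_apply (id_blinfun - y) v"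
      by (simp add: blinfun.bilinear_simps scaleR_2)
  qed
  have comm: "c \<star> x = x \<star> c" if c: "c \<in> S" and cy: "c \<star> y = y \<star> c" for c
  proof -
    have cy': "blinfun_apply c (blinfun_apply y v) = blinfun_apply y (blinfun_apply c v)" for v
      using arg_cong[OF cy, of "\<lambda>T. blinfun_apply T v"] by simp
    have cp: "blinfun_apply c (blinfun_apply (p n) v) = blinfun_apply (p n) (blinfun_apply c v)" for n v
      by (induction n arbitrary: v) (simp_all add: p0 pS blinfun.bilinear_simps cy')
    have "N (c \<star> x - x \<star> c) \<le> (2 * N c) * N (p n - x)" for n
    proof -
      have "c \<star> x - x \<star> c = (p n - x) \<star> c - c \<star> (p n - x)"
        by (rule blinfun_eqI) (simp add: blinfun.bilinear_simps cp)
      hence "N (c \<star> x - x \<star> c) \<le> N ((p n - x) \<star> c) + N (c \<star> (p n - x))"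
        using N_diff_le[of "(p n - x) \<star> c" "c \<star> (p n - x)"] c x p by simp
      thus ?thesis
        using N_compose[of c "p n - x"] N_compose[of "p n - x" c] c x p
        by (simp add: mult.commute[of _ "N c"])
    qed
    hence "c \<star> x - x \<star> c = 0"
      by (intro eq_zero_if_N_squeezed[OF _ _ tendsto_mult_right_zero[OF lim]]) (simp_all add: c x)
    thus ?thesis by simp
  qed
  show ?thesis by (rule that[OF x xadj x1 sqrt comm])
qed

lemma N_self_adjoint_sq: "x \<in> S \<Longrightarrow> x\<^sup>\<dagger> = x \<Longrightarrow> N (x \<star> x) = (N x)\<^sup>2"
  using N_cstar[of x] by simp

text \<open>For commuting self-adjoint \<open>x\<close> and \<open>t\<close> the element \<open>x + it\<close> has real part \<open>x\<close> and squared modulus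
  \<open>x\<^sup>2 + t\<^sup>2\<close>. Thus a square is dominated in norm by any sum of commuting squares, which replaces the
  monotonicity of the norm on positive elements.\<close>

lemma N_sum_squares:
  assumes x: "x \<in> S" "x\<^sup>\<dagger> = x" and t: "t \<in> S" "t\<^sup>\<dagger> = t" and comm: "t \<star> x = x \<star> t"
  shows "(N x)\<^sup>2 \<le> (N (x + cscale bop_alg \<i> t))\<^sup>2"
    and "(N (x + cscale bop_alg \<i> t))\<^sup>2 = N (x \<star> x + t \<star> t)"
proof -
  define z where "z = x + cscale bop_alg \<i> t"
  have z: "z \<in> S" using x t by (simp add: z_def)
  have zadj: "z\<^sup>\<dagger> = x - cscale bop_alg \<i> t"
  proof -
    have "cscale bop_alg (- \<i>) t = - cscale bop_alg \<i> t"
      by (rule blinfun_eqI)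
        (simp add: blinfun_apply_cscale blinfun.bilinear_simps scaleC_minus_one[symmetric] scaleC_scaleC)
    thus ?thesis using x t by (simp add: z_def hadjoint_simps)
  qed
  have "x = (1/2) *\<^sub>R (z + z\<^sup>\<dagger>)" unfolding zadj by (simp add: z_def flip: scaleR_2)
  hence "N x = (1/2) * N (z + z\<^sup>\<dagger>)" using N_scaleR[of "z + z\<^sup>\<dagger>" "1/2"] z by simp
  hence "N x \<le> N z" using N_triangle[of z "z\<^sup>\<dagger>"] N_hadjoint[OF z] z by simp
  thus "(N x)\<^sup>2 \<le> (N (x + cscale bop_alg \<i> t))\<^sup>2"
    using N_ge_zero[OF x(1)] unfolding z_def by (intro power_mono)
  have comm': "blinfun_apply t (blinfun_apply x v) = blinfun_apply x (blinfun_apply t v)" for v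
    using arg_cong[OF comm, of "\<lambda>T. blinfun_apply T v"] by simp
  have lin: "blinfun_apply x (c *\<^sub>C v) = c *\<^sub>C blinfun_apply x v" 
    "blinfun_apply t (c *\<^sub>C v) = c *\<^sub>C blinfun_apply t v" for c v
    using x t mem_bop carrier_bop by blast+
  have "z\<^sup>\<dagger> \<star> z = x \<star> x + t \<star> t"
    unfolding zadj unfolding z_def
    by (rule blinfun_eqI)
      (simp add: blinfun_apply_cscale blinfun.bilinear_simps lin comm' scaleC_scaleC scaleC_minus_one)
  thus "(N (x + cscale bop_alg \<i> t))\<^sup>2 = N (x \<star> x + t \<star> t)"
    using N_cstar[OF z] by (simp add: z_def)
qed

lemma N_le_of_sum_squares:
  assumes "x \<in> S" "x\<^sup>\<dagger> = x" "t \<in> S" "t\<^sup>\<dagger> = t" "t \<star> x = x \<star> t"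
  shows "(N x)\<^sup>2 \<le> N (x \<star> x + t \<star> t)"
  using N_sum_squares[OF assms] by simp

text \<open>With \<open>k = \<surd>(1 - d\<^sup>2)\<close> the element \<open>u = d + ik\<close> is unitary, so \<open>u\<^sup>2\<close> and its real part \<open>2d\<^sup>2 - 1\<close> have norm
  at most one; finally \<open>1 - d\<^sup>2\<close> is the average of \<open>1\<close> and \<open>1 - 2d\<^sup>2\<close>. This stands in for the statement
  that the spectrum of \<open>d\<close> lies in \<open>[-1, 1]\<close>.\<close>

lemma N_one_minus_square:
  assumes d: "d \<in> S" "d\<^sup>\<dagger> = d" "N d \<le> 1"
  shows "N (id_blinfun - d \<star> d) \<le> 1"
proof -
  have dd: "d \<star> d \<in> S" "(d \<star> d)\<^sup>\<dagger> = d \<star> d" "N (d \<star> d) \<le> 1"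
    using d N_self_adjoint_sq[OF d(1,2)] N_ge_zero[OF d(1)] by (simp_all add: hadjoint_simps power_le_one)
  obtain x where x: "x \<in> S" "x\<^sup>\<dagger> = x" "(id_blinfun - x) \<star> (id_blinfun - x) = id_blinfun - d \<star> d"
    and xd: "\<And>c. c \<in> S \<Longrightarrow> c \<star> (d \<star> d) = (d \<star> d) \<star> c \<Longrightarrow> c \<star> x = x \<star> c"
    using sqrt_exists[OF dd] by metis
  define k where "k = id_blinfun - x"
  have k: "k \<in> S" "k\<^sup>\<dagger> = k" "k \<star> k = id_blinfun - d \<star> d"
    using x by (simp_all add: k_def hadjoint_simps)
  have "d \<star> x = x \<star> d" using xd[OF d(1)] by (simp add: blinfun_compose_assoc)
  hence comm: "k \<star> d = d \<star> k"
    by (simp add: k_def bounded_bilinear.diff_left[OF bounded_bilinear_blinfun_compose]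
        bounded_bilinear.diff_right[OF bounded_bilinear_blinfun_compose])
  define u where "u = d + cscale bop_alg \<i> k"
  have u: "u \<in> S" using d k by (simp add: u_def)
  have "(N u)\<^sup>2 = N (d \<star> d + k \<star> k)" unfolding u_def by (rule N_sum_squares(2)[OF d(1,2) k(1,2) comm])
  hence "(N u)\<^sup>2 \<le> 1" using N_id_le by (simp add: k)
  hence uu: "N (u \<star> u) \<le> 1" using N_compose[OF u u] by (simp add: power2_eq_square)
  have comm': "blinfun_apply k (blinfun_apply d v) = blinfun_apply d (blinfun_apply k v)" for v
    using arg_cong[OF comm, of "\<lambda>T. blinfun_apply T v"] by simp
  have kk': "blinfun_apply k (blinfun_apply k v) = v - blinfun_apply d (blinfun_apply d v)" for v
    using arg_cong[OF k(3), of "\<lambda>T. blinfun_apply T v"] by (simp add: blinfun.bilinear_simps)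
  have lin: "blinfun_apply k (c *\<^sub>C v) = c *\<^sub>C blinfun_apply k v" 
    "blinfun_apply d (c *\<^sub>C v) = c *\<^sub>C blinfun_apply d v" for c v
    using k d mem_bop carrier_bop by blast+
  \<comment> \<open>real part of \<open>u\<^sup>2\<close>; the imaginary part is \<open>2dk\<close>\<close>
  define q where "q = (2 *\<^sub>R d) \<star> d - id_blinfun"
  have qS: "q \<in> S" "q\<^sup>\<dagger> = q" using d by (simp_all add: q_def hadjoint_simps)
    (auto intro: blinfun_eqI simp: blinfun.bilinear_simps)
  have mS: "d \<star> k \<in> S" "(2 *\<^sub>R (d \<star> k))\<^sup>\<dagger> = 2 *\<^sub>R (d \<star> k)"
    using d k comm by (simp_all add: hadjoint_simps)
  have "u \<star> u = q + cscale bop_alg \<i> (2 *\<^sub>R (d \<star> k))"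
    unfolding u_def q_def
    by (rule blinfun_eqI)
      (simp add: blinfun_apply_cscale blinfun.bilinear_simps lin comm' scaleC_scaleC scaleC_minus_one
        kk' scaleR_2 scaleC_add_right algebra_simps)
  moreover have "(2 *\<^sub>R (d \<star> k)) \<star> q = q \<star> (2 *\<^sub>R (d \<star> k))"
    unfolding q_def by (rule blinfun_eqI) (simp add: blinfun.bilinear_simps comm' scaleR_diff_right)
  ultimately have "(N q)\<^sup>2 \<le> (N (u \<star> u))\<^sup>2"
    using N_sum_squares(1)[OF qS _ mS(2)] mS(1) by simp
  hence q1: "N q \<le> 1"
    using uu N_ge_zero[of "u \<star> u"] u by (meson compose_mem order_trans power2_le_imp_le)
  have "id_blinfun - q = 2 *\<^sub>R (id_blinfun - d \<star> d)"
    by (rule blinfun_eqI) (simp add: q_def blinfun.bilinear_simps scaleR_2)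
  hence "id_blinfun - d \<star> d = (1/2) *\<^sub>R (id_blinfun - q)" by simp
  thus ?thesis using N_diff_le[OF id_mem qS(1)] qS N_id_le q1 by (simp add: N_scaleR)
qed

text \<open>Here \<open>t\<close> is the square root of \<open>|d|\<close>. After scaling \<open>d\<close> to norm one, \<open>|d|\<close> is the square root of
  \<open>1 - (1 - d\<^sup>2)\<close>, which has the form \<open>1 - x\<close> with \<open>N x \<le> 1\<close>, so that a second root can be extracted.
  Having \<open>|d|\<close> as a square makes its positivity visible.\<close>

lemma abs_square_root_exists:
  assumes d: "d \<in> S" "d\<^sup>\<dagger> = d"
  obtains t where "t \<in> S" "t\<^sup>\<dagger> = t" "(t \<star> t) \<star> (t \<star> t) = d \<star> d"
    "\<And>c. c \<in> S \<Longrightarrow> c \<star> d = d \<star> c \<Longrightarrow> c \<star> t = t \<star> c"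
proof (cases "N d = 0")
  case True
  hence "d = 0" using N_eq_zero d by simp
  thus ?thesis by (intro that[of 0]) simp_all
next
  case False
  define n where "n = N d"
  have n: "n > 0" using False N_ge_zero[OF d(1)] by (simp add: n_def)
  define e where "e = (1 / n) *\<^sub>R d"
  have e: "e \<in> S" "e\<^sup>\<dagger> = e" "N e \<le> 1"
    using d n by (simp_all add: e_def hadjoint_simps N_scaleR) (simp add: n_def)
  define y where "y = id_blinfun - e \<star> e"
  have y: "y \<in> S" "y\<^sup>\<dagger> = y" "N y \<le> 1"
    using e N_one_minus_square[OF e] by (simp_all add: y_def hadjoint_simps)
  obtain x where x: "x \<in> S" "x\<^sup>\<dagger> = x" "N x \<le> 1" "(id_blinfun - x) \<star> (id_blinfun - x) = id_blinfun - y"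
    and xc: "\<And>c. c \<in> S \<Longrightarrow> c \<star> y = y \<star> c \<Longrightarrow> c \<star> x = x \<star> c"
    using sqrt_exists[OF y] by metis
  obtain w where w: "w \<in> S" "w\<^sup>\<dagger> = w" "(id_blinfun - w) \<star> (id_blinfun - w) = id_blinfun - x"
    and wc: "\<And>c. c \<in> S \<Longrightarrow> c \<star> x = x \<star> c \<Longrightarrow> c \<star> w = w \<star> c"
    using sqrt_exists[OF x(1-3)] by metis
  define s where "s = id_blinfun - w"
  have s: "s \<in> S" "s\<^sup>\<dagger> = s" "(s \<star> s) \<star> (s \<star> s) = e \<star> e"
    using w x by (simp_all add: s_def y_def hadjoint_simps)
  define t where "t = sqrt n *\<^sub>R s"
  show ?thesis
  proof (rule that)
    show "t \<in> S" "t\<^sup>\<dagger> = t" using s by (simp_all add: t_def hadjoint_simps)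
    show "(t \<star> t) \<star> (t \<star> t) = d \<star> d"
    proof -
      have d': "d = n *\<^sub>R e" using n by (simp add: e_def)
      have "(t \<star> t) \<star> (t \<star> t) = (n * n) *\<^sub>R ((s \<star> s) \<star> (s \<star> s))"
        using n by (intro blinfun_eqI) (simp add: t_def blinfun.bilinear_simps flip: mult.assoc)
      also have "\<dots> = d \<star> d"
        unfolding s d' by (intro blinfun_eqI) (simp add: blinfun.bilinear_simps)
      finally show ?thesis .
    qed
    show "c \<star> t = t \<star> c" if c: "c \<in> S" "c \<star> d = d \<star> c" for c
    proof -
      have cd: "blinfun_apply c (blinfun_apply d v) = blinfun_apply d (blinfun_apply c v)" for v
        using arg_cong[OF c(2), of "\<lambda>T. blinfun_apply T v"] by simp
      have "c \<star> y = y \<star> c"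
        by (rule blinfun_eqI) (simp add: y_def e_def blinfun.bilinear_simps cd)
      hence "c \<star> w = w \<star> c" using wc xc c by blast
      hence "blinfun_apply c (blinfun_apply w v) = blinfun_apply w (blinfun_apply c v)" for v
        by (metis blinfun_apply_blinfun_compose)
      thus ?thesis by (intro blinfun_eqI) (simp add: t_def s_def blinfun.bilinear_simps)
    qed
  qed
qed

text \<open>With \<open>c = (N m)\<^sup>2\<close> one has \<open>N (c - m\<^sup>2) \<le> c\<close>, so \<open>g \<mapsto> (1 + (c - m\<^sup>2) g) / (1 + c)\<close> is a contraction
  with constant \<open>c / (1 + c)\<close>; its fixed point inverts \<open>1 + m\<^sup>2\<close>.\<close>

lemma inverse_one_plus_square:
  assumes m: "m \<in> S" "m\<^sup>\<dagger> = m"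
  obtains g where "g \<in> S" "(id_blinfun + m \<star> m) \<star> g = id_blinfun"
proof -
  define c where "c = (N m)\<^sup>2"
  have c: "c \<ge> 0" by (simp add: c_def)
  define b where "b = c *\<^sub>R id_blinfun - m \<star> m"
  have b: "b \<in> S" using m by (simp add: b_def)
  have Nb: "N b \<le> c"
  proof (cases "N m = 0")
    case True
    hence "b = 0" using m N_eq_zero by (simp add: b_def c_def)
    thus ?thesis using c N_eq_zero[of 0] by simp
  next
    case False
    define e where "e = (1 / N m) *\<^sub>R m"
    have n: "N m > 0" using False N_ge_zero[OF m(1)] by simp
    have e: "e \<in> S" "e\<^sup>\<dagger> = e" "N e \<le> 1" using m n by (simp_all add: e_def hadjoint_simps N_scaleR)
    have "b = c *\<^sub>R (id_blinfun - e \<star> e)"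
      using n by (intro blinfun_eqI) (simp add: b_def e_def c_def blinfun.bilinear_simps
          scaleR_diff_right power2_eq_square)
    hence "N b = c * N (id_blinfun - e \<star> e)" using c e by (simp add: N_scaleR)
    thus ?thesis using mult_left_mono[OF N_one_minus_square[OF e] c] by simp
  qed
  define \<theta> where "\<theta> = c / (1 + c)"
  have \<theta>: "0 \<le> \<theta>" "\<theta> \<le> 1" "1 - \<theta> = 1 / (1 + c)" using c by (simp_all add: \<theta>_def field_simps)
  define p where "p = rec_nat 0 (\<lambda>_ q. (1 / (1 + c)) *\<^sub>R (id_blinfun + b \<star> q))"
  have p0: "p 0 = 0" and pS: "p (Suc n) = (1 / (1 + c)) *\<^sub>R (id_blinfun + b \<star> p n)" for n
    by (simp_all add: p_def)
  have p: "p n \<in> S" for n by (induction n) (simp_all add: p0 pS b)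
  have contract: "N (p (Suc n) - (1 / (1 + c)) *\<^sub>R (id_blinfun + b \<star> q)) \<le> \<theta> * N (p n - q)"
    if "q \<in> S" for n q
  proof -
    have "p (Suc n) - (1 / (1 + c)) *\<^sub>R (id_blinfun + b \<star> q) = (1 / (1 + c)) *\<^sub>R (b \<star> (p n - q))"
      by (rule blinfun_eqI) (simp add: pS blinfun.bilinear_simps flip: scaleR_diff_right)
    hence "N (p (Suc n) - (1 / (1 + c)) *\<^sub>R (id_blinfun + b \<star> q)) = (1 / (1 + c)) * N (b \<star> (p n - q))"
      using c b p that by (simp add: N_scaleR)
    also have "\<dots> \<le> (1 / (1 + c)) * (c * N (p n - q))"
      using c N_compose[of b "p n - q"] mult_right_mono[OF Nb N_ge_zero[of "p n - q"]] b p that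
      by (intro mult_left_mono) auto
    finally show ?thesis by (simp add: \<theta>_def)
  qed
  have step: "N (p (Suc n) - p n) \<le> (1 - \<theta> ^ Suc n) - (1 - \<theta> ^ n)" for n
  proof (induction n)
    case 0
    have "N (p (Suc 0) - p 0) = (1 / (1 + c)) * N id_blinfun" using c by (simp add: p0 pS N_scaleR)
    also have "\<dots> \<le> 1 / (1 + c)" using c N_id_le by (simp add: divide_right_mono)
    finally show ?case using \<theta>(3) by simp
  next
    case (Suc n)
    have "N (p (Suc (Suc n)) - p (Suc n)) \<le> \<theta> * N (p (Suc n) - p n)"
      using contract[OF p, of "Suc n" n] by (simp add: pS[of n])
    also have "\<dots> \<le> \<theta> * ((1 - \<theta> ^ Suc n) - (1 - \<theta> ^ n))" by (rule mult_left_mono[OF Suc \<theta>(1)])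
    finally show ?case by (simp add: algebra_simps)
  qed
  have "1 - \<theta> ^ n \<le> 1" for n using \<theta>(1) by simp
  then obtain g where g: "g \<in> S" and lim: "(\<lambda>n. N (p n - g)) \<longlonglongrightarrow> 0"
    using majorized_limit[of p "\<lambda>n. 1 - \<theta> ^ n" 1, OF p step] by blast
  define g' where "g' = (1 / (1 + c)) *\<^sub>R (id_blinfun + b \<star> g)"
  have g': "g' \<in> S" using g b by (simp add: g'_def)
  have "N (g - g') \<le> N (p (Suc n) - g) + \<theta> * N (p n - g)" for n
    using N_triangle[of "g - p (Suc n)" "p (Suc n) - g'"] contract[OF g, of n, folded g'_def]
      N_minus_commute[OF g p] g g' p by simp
  moreover have "(\<lambda>n. N (p (Suc n) - g) + \<theta> * N (p n - g)) \<longlonglongrightarrow> 0"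
    using tendsto_add[OF LIMSEQ_Suc[OF lim] tendsto_mult_right_zero[OF lim, of \<theta>]] by simp
  ultimately have "g - g' = 0" by (intro eq_zero_if_N_squeezed) (auto simp: g g')
  hence "(1 + c) *\<^sub>R g = (1 + c) *\<^sub>R g'" by simp
  hence "(1 + c) *\<^sub>R g = id_blinfun + b \<star> g" using c by (simp add: g'_def)
  hence *: "(1 + c) *\<^sub>R blinfun_apply g v = v + blinfun_apply b (blinfun_apply g v)" for v
    by (metis blinfun.add_left blinfun.scaleR_left blinfun_apply_blinfun_compose blinfun_apply_id_blinfun)
  have "(id_blinfun + m \<star> m) \<star> g = id_blinfun"
  proof (rule blinfun_eqI)
    fix v
    show "blinfun_apply ((id_blinfun + m \<star> m) \<star> g) v = blinfun_apply id_blinfun v"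
      using *[of v] by (simp add: b_def blinfun.bilinear_simps algebra_simps)
  qed
  thus ?thesis using that g by blast
qed

end



definition projection :: "('h::chilbert_space \<Rightarrow>\<^sub>L 'h) \<Rightarrow> bool" where
  "projection p \<longleftrightarrow> p \<in> carrier bop_alg \<and> p\<^sup>\<dagger> = p \<and> p \<star> p = p"

lemma projectionD:
  assumes "projection p"
  shows "p \<in> carrier bop_alg" "p\<^sup>\<dagger> = p" "p \<star> p = p"
    "blinfun_apply p (blinfun_apply p v) = blinfun_apply p v"
    "cinner (blinfun_apply p v) w = cinner v (blinfun_apply p w)"
proof -
  show p: "p \<in> carrier bop_alg" "p\<^sup>\<dagger> = p" "p \<star> p = p" using assms by (simp_all add: projection_def)
  show "blinfun_apply p (blinfun_apply p v) = blinfun_apply p v"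
    using arg_cong[OF p(3), of "\<lambda>T. blinfun_apply T v"] by simp
  show "cinner (blinfun_apply p v) w = cinner v (blinfun_apply p w)"
    using cinner_hadjoint_right[OF p(1), of v w] p(2) by simp
qed

lemma projection_id [simp]: "projection id_blinfun"
  by (simp add: projection_def)

lemma projection_complement:
  assumes "projection p"
  shows "projection (id_blinfun - p)"
proof -
  have "(id_blinfun - p) \<star> (id_blinfun - p) = id_blinfun - p"
    by (rule blinfun_eqI) (simp add: blinfun.bilinear_simps projectionD(4)[OF assms])
  thus ?thesis using projectionD(1,2)[OF assms] by (simp add: projection_def hadjoint_simps)
qed

lemma projection_norm_le:
  assumes "projection p"
  shows "norm p \<le> 1"
proof (rule norm_blinfun_bound)
  fix v
  show "norm (blinfun_apply p v) \<le> 1 * norm v"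
  proof (cases "blinfun_apply p v = 0")
    case False
    have "(norm (blinfun_apply p v))\<^sup>2 = Re (cinner v (blinfun_apply p v))"
      using arg_cong[OF projectionD(5)[OF assms, of v "blinfun_apply p v"], of Re]
      by (simp add: cinner_self projectionD[OF assms])
    also have "\<dots> \<le> norm v * norm (blinfun_apply p v)"
      using complex_Re_le_cmod cauchy_schwarz order_trans by blast
    finally show ?thesis using False by (simp add: power2_eq_square)
  qed simp
qed simp

lemma compose_commuteD: "a \<star> b = b \<star> a \<Longrightarrow> blinfun_apply a (blinfun_apply b v) = blinfun_apply b (blinfun_apply a v)"
  by (metis blinfun_apply_blinfun_compose)

text \<open>If \<open>d\<close> is negative on the range of \<open>p\<close>, then \<open>|d| = t\<^sup>2\<close> equals \<open>-d\<close> there. A vector \<open>y\<close> in the range of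
  \<open>p (t\<^sup>2 + d)\<close> is annihilated by \<open>t\<^sup>2 - d\<close>, since \<open>t\<^sup>4 = d\<^sup>2\<close>; as \<open>t\<^sup>2\<close> and \<open>-d\<close> are both positive at \<open>y\<close>,
  each of them vanishes at \<open>y\<close>, and then so does \<open>t\<^sup>2 + d\<close>, which forces \<open>y = 0\<close>.\<close>

lemma abs_plus_annihilated:
  assumes p: "projection p"
    and t: "t \<in> carrier bop_alg" "t\<^sup>\<dagger> = t" and d: "d \<in> carrier bop_alg" "d\<^sup>\<dagger> = d"
    and td: "d \<star> t = t \<star> d" and pt: "p \<star> t = t \<star> p" and pd: "p \<star> d = d \<star> p"
    and eq: "(t \<star> t) \<star> (t \<star> t) = d \<star> d"
    and neg: "\<And>v. Re (cinner (blinfun_apply d (blinfun_apply p v)) (blinfun_apply p v)) \<le> 0"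
  shows "p \<star> (t \<star> t + d) = 0"
proof (rule blinfun_eqI)
  fix v
  define e where "e = t \<star> t + d"
  note c = compose_commuteD[OF td] compose_commuteD[OF pt] compose_commuteD[OF pd]
  have quad: "blinfun_apply t (blinfun_apply t (blinfun_apply t (blinfun_apply t w)))
      = blinfun_apply d (blinfun_apply d w)" for w
    using arg_cong[OF eq, of "\<lambda>T. blinfun_apply T w"] by simp
  define y where "y = blinfun_apply p (blinfun_apply e v)"
  have py: "blinfun_apply p y = y" by (simp add: y_def projectionD[OF p])
  have fy: "blinfun_apply t (blinfun_apply t y) = blinfun_apply d y"
    by (simp add: y_def e_def blinfun.bilinear_simps c quad)
  have sym: "cinner (blinfun_apply t a) b = cinner a (blinfun_apply t b)"
    "cinner (blinfun_apply d a) b = cinner a (blinfun_apply d b)" for a b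
    using cinner_hadjoint_right[of t a b] cinner_hadjoint_right[of d a b] t d by simp_all
  have "(norm (blinfun_apply t y))\<^sup>2 = Re (cinner (blinfun_apply t (blinfun_apply t y)) y)"
    using sym(1)[of "blinfun_apply t y" y] by (simp add: cinner_self)
  also have "\<dots> \<le> 0" using neg[of y] by (simp add: fy py)
  finally have ty: "blinfun_apply t y = 0" by simp
  have ey: "blinfun_apply e y = 0" by (simp add: e_def blinfun.bilinear_simps ty flip: fy)
  have "cinner y y = cinner (blinfun_apply e v) y"
    by (subst (1) y_def) (simp add: projectionD(5)[OF p] py)
  also have "\<dots> = cinner v (blinfun_apply e y)"
    by (simp add: e_def blinfun.bilinear_simps cinner_simps sym)
  finally have "y = 0" by (simp add: ey cinner_eq_zero)
  thus "blinfun_apply (p \<star> (t \<star> t + d)) v = blinfun_apply 0 v"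
    by (simp add: y_def e_def)
qed

context complete_cstar_norm
begin

text \<open>For \<open>y = x\<^sup>\<dagger>x / (N x)\<^sup>2\<close> the element \<open>1 - y\<close> is the square of a self-adjoint element, hence positive as
  an operator.\<close>

lemma norm_le_N:
  assumes x: "x \<in> S"
  shows "norm x \<le> N x"
proof (cases "N x = 0")
  case True
  thus ?thesis using N_eq_zero[OF x] by simp
next
  case False
  define n where "n = N x"
  have n: "n > 0" using False N_ge_zero[OF x] by (simp add: n_def)
  define y where "y = (1 / n\<^sup>2) *\<^sub>R (x\<^sup>\<dagger> \<star> x)"
  have y: "y \<in> S" "y\<^sup>\<dagger> = y" "N y \<le> 1"
    using x n by (simp_all add: y_def hadjoint_simps N_scaleR N_cstar) (simp add: n_def)
  obtain w where w: "w \<in> S" "w\<^sup>\<dagger> = w" "(id_blinfun - w) \<star> (id_blinfun - w) = id_blinfun - y"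
    using sqrt_exists[OF y] by metis
  define k where "k = id_blinfun - w"
  have k: "k \<in> S" "k\<^sup>\<dagger> = k" "k \<star> k = id_blinfun - y" using w by (simp_all add: k_def hadjoint_simps)
  have "norm (blinfun_apply x v) \<le> n * norm v" for v
  proof (rule power2_le_imp_le)
    have "0 \<le> Re (cinner (blinfun_apply k v) (blinfun_apply k v))" by (rule cinner_ge_zero)
    also have "cinner (blinfun_apply k v) (blinfun_apply k v) = cinner v (blinfun_apply (k \<star> k) v)"
      using cinner_hadjoint_right[of k v "blinfun_apply k v"] k(1,2) by simp
    also have "\<dots> = cinner v v - cinner v (blinfun_apply y v)"
      unfolding k(3) by (simp add: blinfun.bilinear_simps cinner_diff_right)
    also have "cinner v (blinfun_apply y v) = of_real ((1 / n\<^sup>2) * (norm (blinfun_apply x v))\<^sup>2)"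
      using x by (simp add: y_def blinfun.bilinear_simps cinner_scaleR_right cinner_hadjoint_right cinner_self)
    finally have "(norm (blinfun_apply x v))\<^sup>2 / n\<^sup>2 \<le> (norm v)\<^sup>2" by (simp add: cinner_self)
    thus "(norm (blinfun_apply x v))\<^sup>2 \<le> (n * norm v)\<^sup>2"
      using n by (simp add: power_mult_distrib field_simps)
  qed (use n in simp)
  thus ?thesis using n unfolding n_def by (intro norm_blinfun_bound) auto
qed

text \<open>The C*-identity reduces the inequality \<open>N x \<le> norm x\<close> to self-adjoint \<open>x\<close>. With \<open>s = (norm x)\<^sup>2\<close> the
  operator \<open>x\<^sup>2 - s\<close> is negative, so minus it is its own absolute value \<open>t\<^sup>2\<close>; that is, \<open>x\<^sup>2 + t\<^sup>2 = s\<close> with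
  \<open>t\<close> in the algebra, and \<open>x\<^sup>2\<close> is dominated by this sum in the norm \<open>N\<close>.\<close>

theorem N_eq_norm:
  assumes "x \<in> S"
  shows "N x = norm x"
proof (rule antisym[OF _ norm_le_N[OF assms]])
  have self: "N x \<le> norm x" if x: "x \<in> S" "x\<^sup>\<dagger> = x" for x
  proof (rule power2_le_imp_le)
    define s where "s = (norm x)\<^sup>2"
    define d where "d = x \<star> x - s *\<^sub>R id_blinfun"
    have d: "d \<in> S" "d\<^sup>\<dagger> = d" using x by (simp_all add: d_def hadjoint_simps)
    obtain t where t: "t \<in> S" "t\<^sup>\<dagger> = t" "(t \<star> t) \<star> (t \<star> t) = d \<star> d"
      and tc: "\<And>c. c \<in> S \<Longrightarrow> c \<star> d = d \<star> c \<Longrightarrow> c \<star> t = t \<star> c"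
      using abs_square_root_exists[OF d] by metis
    have neg: "Re (cinner (blinfun_apply d v) v) \<le> 0" for v
    proof -
      have "cinner (blinfun_apply x (blinfun_apply x v)) v = cinner (blinfun_apply x v) (blinfun_apply x v)"
        using cinner_hadjoint_left[of x "blinfun_apply x v" v] x by simp
      hence "Re (cinner (blinfun_apply d v) v) = (norm (blinfun_apply x v))\<^sup>2 - s * (norm v)\<^sup>2"
        by (simp add: d_def blinfun.bilinear_simps cinner_simps cinner_self)
      also have "\<dots> \<le> 0"
        using power_mono[OF norm_blinfun[of x v], of 2] by (simp add: s_def power_mult_distrib)
      finally show ?thesis .
    qed
    have "id_blinfun \<star> (t \<star> t + d) = 0"
      by (rule abs_plus_annihilated[OF projection_id _ t(2) _ d(2) tc[OF d(1) refl] _ _ t(3)])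
        (simp_all add: t d neg)
    hence "x \<star> x + t \<star> t = s *\<^sub>R id_blinfun" by (simp add: d_def algebra_simps)
    moreover have "x \<star> d = d \<star> x"
      by (rule blinfun_eqI) (simp add: d_def blinfun.bilinear_simps)
    ultimately have "(N x)\<^sup>2 \<le> N (s *\<^sub>R id_blinfun)"
      using N_le_of_sum_squares[OF x t(1,2)] tc[OF x(1)] by simp
    also have "\<dots> \<le> s" using N_id_le by (simp add: N_scaleR s_def mult_left_le)
    finally show "(N x)\<^sup>2 \<le> (norm x)\<^sup>2" by (simp add: s_def)
  qed simp
  have "(N x)\<^sup>2 \<le> norm (x\<^sup>\<dagger> \<star> x)"
    using self[of "x\<^sup>\<dagger> \<star> x"] assms by (simp add: N_cstar hadjoint_simps)
  also have "\<dots> = (norm x)\<^sup>2" using assms by (simp add: norm_hadjoint_compose)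
  finally show "N x \<le> norm x" by (rule power2_le_imp_le) simp
qed

end

section \<open>Compressing a closed algebra of operators by a commuting projection\<close>

locale closed_operator_star_algebra = operator_star_algebra S
  for S :: "('h::chilbert_space \<Rightarrow>\<^sub>L 'h) set" +
  assumes closed: "closed S"
begin

sublocale complete_cstar_norm S norm
proof
  fix s :: "nat \<Rightarrow> 'h \<Rightarrow>\<^sub>L 'h"
  assume s: "range s \<subseteq> S" and C: "\<forall>e>0. \<exists>M. \<forall>m\<ge>M. \<forall>n\<ge>M. norm (s m - s n) < e"
  hence "Cauchy s" unfolding Cauchy_def dist_norm by simp
  then obtain x where x: "s \<longlonglongrightarrow> x" using Cauchy_convergent convergent_def by blast
  moreover have "x \<in> S" using closed s x closed_sequentially by blast
  ultimately show "\<exists>x\<in>S. (\<lambda>n. norm (s n - x)) \<longlonglongrightarrow> 0"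
    using LIM_zero tendsto_norm_zero by blast
qed (auto simp: norm_bop_cscale norm_hadjoint_compose norm_triangle_ineq norm_blinfun_compose)

end

locale commuting_projection = closed_operator_star_algebra S
  for S :: "('h::chilbert_space \<Rightarrow>\<^sub>L 'h) set" +
  fixes p :: "'h \<Rightarrow>\<^sub>L 'h"
  assumes projection: "projection p"
    and commute: "x \<in> S \<Longrightarrow> p \<star> x = x \<star> p"
begin

text \<open>Put \<open>d = x\<^sup>\<dagger>x - s\<close> with \<open>s = (norm (p \<star> x))\<^sup>2\<close> and \<open>e = |d| + d\<close>. Then \<open>p e = 0\<close> and
  \<open>x\<^sup>\<dagger>x = s + e - |d| \<le> s + e\<close>. The element \<open>g = (1 + e\<^sup>2 / \<delta>\<^sup>2)\<^sup>-\<^sup>1\<close> has norm at most one, equals \<open>1\<close> modulo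
  the kernel of the compression, and satisfies \<open>norm (e g) \<le> \<delta>\<close>, so \<open>x g\<close> is the required small
  representative. Damping by \<open>e\<^sup>2\<close> instead of \<open>e\<close> avoids having to prove that \<open>e\<close> is positive.\<close>

lemma lift_norm_sq:
  assumes x: "x \<in> S" and \<delta>: "\<delta> > 0"
  obtains k where "k \<in> S" "p \<star> k = 0" "(norm (x + k))\<^sup>2 \<le> (norm (p \<star> x))\<^sup>2 + \<delta>"
proof -
  define s where "s = (norm (p \<star> x))\<^sup>2"
  define d where "d = x\<^sup>\<dagger> \<star> x - s *\<^sub>R id_blinfun"
  have d: "d \<in> S" "d\<^sup>\<dagger> = d" using x by (simp_all add: d_def hadjoint_simps)
  obtain t where t: "t \<in> S" "t\<^sup>\<dagger> = t" "(t \<star> t) \<star> (t \<star> t) = d \<star> d" "d \<star> t = t \<star> d"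
    using abs_square_root_exists[OF d] d by metis
  have dval: "Re (cinner (blinfun_apply d v) v) = (norm (blinfun_apply x v))\<^sup>2 - s * (norm v)\<^sup>2" for v
    using x by (simp add: d_def blinfun.bilinear_simps cinner_simps cinner_self cinner_hadjoint_left)
  have neg: "Re (cinner (blinfun_apply d (blinfun_apply p v)) (blinfun_apply p v)) \<le> 0" for v
  proof -
    have "blinfun_apply x (blinfun_apply p v) = blinfun_apply (p \<star> x) (blinfun_apply p v)"
      using compose_commuteD[OF commute[OF x]] projectionD(4)[OF projection] by simp
    hence "norm (blinfun_apply x (blinfun_apply p v)) \<le> norm (p \<star> x) * norm (blinfun_apply p v)"
      by (metis norm_blinfun)
    from power_mono[OF this, of 2] show ?thesis by (simp add: dval s_def power_mult_distrib)
  qed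
  define e where "e = t \<star> t + d"
  have e: "e \<in> S" "e\<^sup>\<dagger> = e" using t d by (simp_all add: e_def hadjoint_simps)
  have "p \<star> e = 0"
    unfolding e_def using abs_plus_annihilated[OF projection _ t(2) _ d(2) t(4) commute commute t(3) neg] t d
    by simp
  hence pe: "blinfun_apply p (blinfun_apply e v) = 0" for v
    by (metis blinfun.zero_left blinfun_apply_blinfun_compose)
  define m where "m = (1 / \<delta>) *\<^sub>R e"
  have "m \<in> S" "m\<^sup>\<dagger> = m" using e by (simp_all add: m_def hadjoint_simps)
  then obtain g where g: "g \<in> S" and inv: "(id_blinfun + m \<star> m) \<star> g = id_blinfun"
    by (rule inverse_one_plus_square)
  have gv: "blinfun_apply g v + (1 / \<delta>\<^sup>2) *\<^sub>R blinfun_apply e (blinfun_apply e (blinfun_apply g v)) = v" for v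
    using arg_cong[OF inv, of "\<lambda>T. blinfun_apply T v"]
    by (simp add: m_def blinfun.bilinear_simps power2_eq_square)
  have bound: "(norm (blinfun_apply x (blinfun_apply g v)))\<^sup>2 \<le> (s + \<delta>) * (norm v)\<^sup>2" for v
  proof -
    define y where "y = blinfun_apply g v"
    have sym: "cinner (blinfun_apply e a) b = cinner a (blinfun_apply e b)"
        "cinner (blinfun_apply t a) b = cinner a (blinfun_apply t b)" for a b
      using cinner_hadjoint_right[of e a b] cinner_hadjoint_right[of t a b] e t by simp_all
    have "cinner v y = cinner y y + (1 / \<delta>\<^sup>2) * cinner (blinfun_apply e y) (blinfun_apply e y)"
      by (subst gv[of v, symmetric]) (simp add: y_def[symmetric] cinner_simps sym)
    hence "Re (cinner v y) = (norm y)\<^sup>2 + (norm (blinfun_apply e y))\<^sup>2 / \<delta>\<^sup>2" 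
      by (simp add: cinner_self flip: of_real_power)
    moreover have "Re (cinner v y) \<le> norm v * norm y"
      using complex_Re_le_cmod cauchy_schwarz order_trans by blast
    ultimately have *: "(norm y)\<^sup>2 + (norm (blinfun_apply e y))\<^sup>2 / \<delta>\<^sup>2 \<le> norm v * norm y" by simp
    have yv: "norm y \<le> norm v"
    proof (cases "y = 0")
      case False
      have "(norm y)\<^sup>2 \<le> norm v * norm y"
        using * by (smt (verit) divide_nonneg_nonneg zero_le_power2)
      thus ?thesis using False by (simp add: power2_eq_square)
    qed simp
    have "(norm (blinfun_apply e y))\<^sup>2 / \<delta>\<^sup>2 \<le> norm v * norm y"
      using * by (smt (verit) zero_le_power2)
    also have "\<dots> \<le> norm v * norm v" by (rule mult_left_mono[OF yv]) simp
    finally have "(norm (blinfun_apply e y))\<^sup>2 \<le> (\<delta> * norm v)\<^sup>2"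
      using \<delta> by (simp add: divide_simps power_mult_distrib power2_eq_square mult_ac)
    hence ey: "norm (blinfun_apply e y) \<le> \<delta> * norm v" by (rule power2_le_imp_le) (use \<delta> in simp)
    have "Re (cinner (blinfun_apply d y) y) = Re (cinner (blinfun_apply e y) y) - (norm (blinfun_apply t y))\<^sup>2"
      by (simp add: e_def blinfun.bilinear_simps cinner_simps sym cinner_self)
    also have "\<dots> \<le> norm (blinfun_apply e y) * norm y"
      using complex_Re_le_cmod[of "cinner (blinfun_apply e y) y"] cauchy_schwarz[of "blinfun_apply e y" y]
      by (smt (verit) zero_le_power2)
    also have "\<dots> \<le> (\<delta> * norm v) * norm v" using ey yv \<delta> by (intro mult_mono) auto
    finally have "(norm (blinfun_apply x y))\<^sup>2 \<le> s * (norm y)\<^sup>2 + \<delta> * (norm v)\<^sup>2"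
      by (simp add: dval power2_eq_square)
    also have "\<dots> \<le> s * (norm v)\<^sup>2 + \<delta> * (norm v)\<^sup>2"
      using yv by (intro add_right_mono mult_left_mono power_mono) (auto simp: s_def)
    finally show ?thesis by (simp add: y_def algebra_simps)
  qed
  have "norm (x \<star> g) \<le> sqrt (s + \<delta>)"
  proof (rule norm_blinfun_bound)
    fix v
    have sd: "s + \<delta> \<ge> 0" using \<delta> by (simp add: s_def)
    show "norm (blinfun_apply (x \<star> g) v) \<le> sqrt (s + \<delta>) * norm v"
      by (rule power2_le_imp_le) (use bound[of v] sd in \<open>simp_all add: power_mult_distrib\<close>)
  qed (use \<delta> in \<open>simp add: s_def\<close>)
  hence "(norm (x \<star> g))\<^sup>2 \<le> (sqrt (s + \<delta>))\<^sup>2" by (rule power_mono) simp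
  hence nrm: "(norm (x + (x \<star> g - x)))\<^sup>2 \<le> s + \<delta>" using \<delta> by (simp add: s_def)
  have "p \<star> (x \<star> g - x) = 0"
  proof (rule blinfun_eqI)
    fix v
    have "blinfun_apply p v = blinfun_apply p (blinfun_apply g v)"
      by (subst gv[of v, symmetric]) (simp add: blinfun.bilinear_simps pe)
    thus "blinfun_apply (p \<star> (x \<star> g - x)) v = blinfun_apply 0 v"
      using compose_commuteD[OF commute[OF x]] by (simp add: blinfun.bilinear_simps)
  qed
  with nrm show ?thesis using that[of "x \<star> g - x"] x g by (simp add: s_def)
qed

lemma lift_norm:
  assumes x: "x \<in> S" and less: "norm (p \<star> x) < r"
  obtains k where "k \<in> S" "p \<star> k = 0" "norm (x + k) < r"
proof -
  have r: "r > 0" using less norm_ge_zero order_le_less_trans by blast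
  define \<delta> where "\<delta> = (r\<^sup>2 - (norm (p \<star> x))\<^sup>2) / 2"
  have "(norm (p \<star> x))\<^sup>2 < r\<^sup>2" using less by (intro power_strict_mono) auto
  hence \<delta>: "\<delta> > 0" "(norm (p \<star> x))\<^sup>2 + \<delta> < r\<^sup>2" by (simp_all add: \<delta>_def field_simps)
  obtain k where k: "k \<in> S" "p \<star> k = 0" "(norm (x + k))\<^sup>2 \<le> (norm (p \<star> x))\<^sup>2 + \<delta>"
    using lift_norm_sq[OF x \<delta>(1)] by blast
  hence "(norm (x + k))\<^sup>2 < r\<^sup>2" using \<delta>(2) by linarith
  hence "norm (x + k) < r" using r by (simp add: power2_less_imp_less)
  thus ?thesis using that k by blast
qed

lemma norm_compress_le: "norm (p \<star> x) \<le> norm x"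
  using norm_blinfun_compose[of p x] mult_right_mono[OF projection_norm_le[OF projection] norm_ge_zero[of x]] by simp

text \<open>The left-hand side is the quotient norm modulo the kernel of the compression.\<close>

lemma compressed_norm:
  assumes x: "x \<in> S"
  shows "Inf {norm (k + x) |k. k \<in> S \<and> p \<star> k = 0} = norm (p \<star> x)"
proof (rule cInf_eq_non_empty)
  have "norm (0 + x) \<in> {norm (k + x) |k. k \<in> S \<and> p \<star> k = 0}"
    using zero_mem by (metis (mono_tags, lifting) blinfun_compose_zero(2) mem_Collect_eq)
  thus "{norm (k + x) |k. k \<in> S \<and> p \<star> k = 0} \<noteq> {}" by blast
next
  fix y assume "y \<in> {norm (k + x) |k. k \<in> S \<and> p \<star> k = 0}"
  then obtain k where k: "y = norm (k + x)" "p \<star> k = 0" by blast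
  have "p \<star> (k + x) = p \<star> x"
    using k(2) by (simp add: bounded_bilinear.add_right[OF bounded_bilinear_blinfun_compose])
  thus "norm (p \<star> x) \<le> y" using norm_compress_le[of "k + x"] k(1) by simp
next
  fix y assume y: "\<And>z. z \<in> {norm (k + x) |k. k \<in> S \<and> p \<star> k = 0} \<Longrightarrow> y \<le> z"
  show "y \<le> norm (p \<star> x)"
  proof (rule dense_ge)
    fix r assume "norm (p \<star> x) < r"
    then obtain k where k: "k \<in> S" "p \<star> k = 0" "norm (x + k) < r" using lift_norm[OF x] by blast
    have "y \<le> norm (k + x)" using k(1,2) by (intro y) blast
    thus "y \<le> r" using k(3) by (simp add: add.commute)
  qed
qed

text \<open>The algebra modulo the kernel is complete: approximate the limit by \<open>p \<star> a k\<close> at a geometric rate, lift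
  the differences of consecutive terms to elements of geometrically small norm, and sum them.\<close>

lemma closed_compression: "closed ((\<star>) p ` S)"
proof (unfold closed_sequential_limits, intro allI impI)
  fix u L assume u: "(\<forall>n. u n \<in> (\<star>) p ` S) \<and> u \<longlonglongrightarrow> L"
  have "\<exists>a\<in>S. norm (p \<star> a - L) < (1/2) ^ k" for k :: nat
  proof -
    have "(1/2::real) ^ k > 0" by simp
    with u obtain n where n: "norm (u n - L) < (1/2) ^ k" by (meson LIMSEQ_D order_refl)
    obtain a where "a \<in> S" "u n = p \<star> a" using u by blast
    with n show ?thesis by auto
  qed
  then obtain a where a: "\<And>k. a k \<in> S" "\<And>k. norm (p \<star> a k - L) < (1/2) ^ k" by metis
  have pdiff: "p \<star> (x - y) = p \<star> x - p \<star> y" for x y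
    by (rule bounded_bilinear.diff_right[OF bounded_bilinear_blinfun_compose])
  have "\<exists>D\<in>S. p \<star> D = p \<star> a (Suc k) - p \<star> a k \<and> norm D < 2 * (1/2) ^ k" for k
  proof -
    have "norm (p \<star> (a (Suc k) - a k)) \<le> norm (p \<star> a (Suc k) - L) + norm (p \<star> a k - L)"
      using norm_triangle_ineq4[of "p \<star> a (Suc k) - L" "p \<star> a k - L"] by (simp add: pdiff)
    also have "\<dots> < (1/2) ^ Suc k + (1/2) ^ k" by (rule add_strict_mono) (rule a)+
    also have "\<dots> \<le> 2 * (1/2) ^ k" by simp
    finally obtain K where K: "K \<in> S" "p \<star> K = 0" "norm (a (Suc k) - a k + K) < 2 * (1/2) ^ k"
      using lift_norm[of "a (Suc k) - a k"] a by auto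
    have "p \<star> (a (Suc k) - a k + K) = p \<star> a (Suc k) - p \<star> a k"
      using K(2) by (simp add: bounded_bilinear.add_right[OF bounded_bilinear_blinfun_compose] pdiff)
    thus ?thesis using K a by (intro bexI[of _ "a (Suc k) - a k + K"]) simp_all
  qed
  then obtain D where D: "\<And>k. D k \<in> S" "\<And>k. p \<star> D k = p \<star> a (Suc k) - p \<star> a k"
    "\<And>k. norm (D k) < 2 * (1/2) ^ k" by metis
  have "summable (\<lambda>k. 2 * (1/2::real) ^ k)" by (intro summable_mult summable_geometric) simp
  hence "summable (\<lambda>k. norm (D k))"
    by (rule summable_comparison_test'[where N=0]) (simp add: D(3) less_imp_le)
  hence sums: "D sums suminf D" using summable_norm_cancel summable_sums by blast
  have part: "(\<Sum>k<n. D k) \<in> S" for n by (induction n) (simp_all add: D)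
  have "suminf D \<in> S"
    by (rule closed_sequentially[OF closed part sums[unfolded sums_def]])
  moreover have "p \<star> suminf D = L - p \<star> a 0"
  proof (rule sums_unique2)
    show "(\<lambda>k. p \<star> D k) sums (p \<star> suminf D)"
      by (rule bounded_linear.sums[OF bounded_bilinear.bounded_linear_right[OF bounded_bilinear_blinfun_compose] sums])
    have "(\<lambda>k. p \<star> a k) \<longlonglongrightarrow> L"
    proof (rule Lim_null[THEN iffD2], rule Lim_null_comparison)
      show "\<forall>\<^sub>F k in sequentially. norm (p \<star> a k - L) \<le> (1/2) ^ k"
        by (intro always_eventually allI less_imp_le a(2))
      show "(\<lambda>k. (1/2::real) ^ k) \<longlonglongrightarrow> 0" by (rule LIMSEQ_power_zero) simp
    qed
    thus "(\<lambda>k. p \<star> D k) sums (L - p \<star> a 0)" unfolding D(2) by (rule telescope_sums)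
  qed
  ultimately have "a 0 + suminf D \<in> S" "p \<star> (a 0 + suminf D) = L"
    using a by (simp_all add: bounded_bilinear.add_right[OF bounded_bilinear_blinfun_compose])
  thus "L \<in> (\<star>) p ` S" by blast
qed

lemma commuting_projection_complement: "commuting_projection S (id_blinfun - p)"
proof
  show "(id_blinfun - p) \<star> x = x \<star> (id_blinfun - p)" if "x \<in> S" for x
    by (rule blinfun_eqI) (simp add: blinfun.bilinear_simps compose_commuteD[OF commute[OF that]])
qed (rule projection_complement[OF projection])

lemma compress_sum:
  assumes "x \<in> S" "y \<in> S"
  shows "p \<star> (p \<star> x + (id_blinfun - p) \<star> y) = p \<star> x"
    and "(id_blinfun - p) \<star> (p \<star> x + (id_blinfun - p) \<star> y) = (id_blinfun - p) \<star> y"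
  by (rule blinfun_eqI, simp add: blinfun.bilinear_simps projectionD(4)[OF projection])+

lemma norm_compress_sum:
  assumes x: "x \<in> S" and y: "y \<in> S"
  shows "norm (p \<star> x + (id_blinfun - p) \<star> y) = max (norm (p \<star> x)) (norm ((id_blinfun - p) \<star> y))"
    (is "norm ?T = ?M")
proof (rule antisym)
  interpret c: commuting_projection S "id_blinfun - p" by (rule commuting_projection_complement)
  let ?q = "id_blinfun - p"
  note pp = projectionD[OF projection] and qq = projectionD[OF c.projection]
  have orth: "cinner (blinfun_apply p v) (blinfun_apply ?q w) = 0" for v w
    by (simp add: pp(5) blinfun.bilinear_simps pp(4))
  have pyth: "(norm (blinfun_apply p v + blinfun_apply ?q w))\<^sup>2
      = (norm (blinfun_apply p v))\<^sup>2 + (norm (blinfun_apply ?q w))\<^sup>2" for v w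
    by (simp add: norm_add_sq orth)
  show "?M \<le> norm ?T"
    using norm_compress_le[of ?T] c.norm_compress_le[of ?T] by (simp add: compress_sum[OF x y])
  have "norm (blinfun_apply ?T v) \<le> ?M * norm v" for v
  proof (rule power2_le_imp_le)
    have M: "?M \<ge> 0" by (simp add: le_max_iff_disj)
    have "norm (blinfun_apply (p \<star> x) (blinfun_apply p v)) \<le> ?M * norm (blinfun_apply p v)"
      by (rule order_trans[OF norm_blinfun]) (intro mult_right_mono, auto)
    moreover have "blinfun_apply (p \<star> x) (blinfun_apply p v) = blinfun_apply p (blinfun_apply x v)"
      using compose_commuteD[OF commute[OF x]] pp(4) by simp
    ultimately have 1: "(norm (blinfun_apply p (blinfun_apply x v)))\<^sup>2 \<le> (?M * norm (blinfun_apply p v))\<^sup>2"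
      by (intro power_mono) simp_all
    have "norm (blinfun_apply (?q \<star> y) (blinfun_apply ?q v)) \<le> ?M * norm (blinfun_apply ?q v)"
      by (rule order_trans[OF norm_blinfun]) (intro mult_right_mono, auto)
    moreover have "blinfun_apply (?q \<star> y) (blinfun_apply ?q v) = blinfun_apply ?q (blinfun_apply y v)"
      using compose_commuteD[OF c.commute[OF y], of v] qq(4)[of "blinfun_apply y v"]
      by (simp only: blinfun_apply_blinfun_compose)
    ultimately have 2: "(norm (blinfun_apply ?q (blinfun_apply y v)))\<^sup>2 \<le> (?M * norm (blinfun_apply ?q v))\<^sup>2"
      by (intro power_mono) simp_all
    have "(norm (blinfun_apply ?T v))\<^sup>2
        = (norm (blinfun_apply p (blinfun_apply x v)))\<^sup>2 + (norm (blinfun_apply ?q (blinfun_apply y v)))\<^sup>2"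
      using pyth[of "blinfun_apply x v" "blinfun_apply y v"]
      by (simp only: blinfun.add_left blinfun_apply_blinfun_compose)
    also have "\<dots> \<le> ?M\<^sup>2 * ((norm (blinfun_apply p v))\<^sup>2 + (norm (blinfun_apply ?q v))\<^sup>2)"
      using add_mono[OF 1 2] by (simp only: power_mult_distrib distrib_left)
    also have "\<dots> = ?M\<^sup>2 * (norm v)\<^sup>2"
      using pyth[of v v] by (simp add: blinfun.bilinear_simps)
    finally show "(norm (blinfun_apply ?T v))\<^sup>2 \<le> (?M * norm v)\<^sup>2" by (simp only: power_mult_distrib)
  qed (simp add: le_max_iff_disj)
  thus "norm ?T \<le> ?M" by (intro norm_blinfun_bound) (auto simp: le_max_iff_disj)
qed

lemma closed_compress_sums: "closed {p \<star> x + (id_blinfun - p) \<star> y |x y. x \<in> S \<and> y \<in> S}" (is "closed ?E")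
proof (unfold closed_sequential_limits, intro allI impI)
  interpret c: commuting_projection S "id_blinfun - p" by (rule commuting_projection_complement)
  fix u L assume u: "(\<forall>n. u n \<in> ?E) \<and> u \<longlonglongrightarrow> L"
  hence lim: "(\<lambda>n. a \<star> u n) \<longlonglongrightarrow> a \<star> L" for a
    by (intro bounded_linear.tendsto[OF bounded_bilinear.bounded_linear_right[OF bounded_bilinear_blinfun_compose]]) simp
  have "p \<star> u n \<in> (\<star>) p ` S \<and> (id_blinfun - p) \<star> u n \<in> (\<star>) (id_blinfun - p) ` S" for n
  proof -
    obtain x y where "x \<in> S" "y \<in> S" "u n = p \<star> x + (id_blinfun - p) \<star> y" using u by blast
    thus ?thesis using compress_sum[of x y] by auto
  qed
  hence "p \<star> L \<in> (\<star>) p ` S" "(id_blinfun - p) \<star> L \<in> (\<star>) (id_blinfun - p) ` S"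
    using closed_sequentially[OF closed_compression _ lim] closed_sequentially[OF c.closed_compression _ lim]
    by blast+
  then obtain x y where "x \<in> S" "y \<in> S" "p \<star> L = p \<star> x" "(id_blinfun - p) \<star> L = (id_blinfun - p) \<star> y"
    by blast
  moreover have "L = p \<star> L + (id_blinfun - p) \<star> L"
    by (rule blinfun_eqI) (simp add: blinfun.bilinear_simps)
  ultimately show "L \<in> ?E" by (metis (mono_tags, lifting) mem_Collect_eq)
qed

end



section \<open>Faithful representations\<close>

lemma abelian_group_bop: "abelian_group bop_alg"
proof (rule abelian_groupI)
  fix x :: "'a::chilbert_space \<Rightarrow>\<^sub>L 'a"
  assume "x \<in> carrier bop_alg"
  hence "- x \<in> carrier bop_alg" using bop_closed(7)[of x "- 1"] by simp
  thus "\<exists>y\<in>carrier bop_alg. y \<oplus>\<^bsub>bop_alg\<^esub> x = \<zero>\<^bsub>bop_alg\<^esub>" by (intro bexI[of _ "- x"]) simp_all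
qed (auto simp: add_ac)

lemma bop_minus:
  assumes "x \<in> carrier bop_alg" "y \<in> carrier bop_alg"
  shows "x \<ominus>\<^bsub>bop_alg\<^esub> y = x - y"
proof -
  interpret abelian_group bop_alg by (rule abelian_group_bop)
  have "- y \<in> carrier bop_alg" using bop_closed(7)[OF assms(2), of "- 1"] by simp
  hence "\<ominus>\<^bsub>bop_alg\<^esub> y = - y" using minus_equality[of "- y" y] assms by simp
  thus ?thesis by (simp add: a_minus_def)
qed

lemma norm_closed_bop:
  assumes "closed S" "S \<subseteq> carrier bop_alg"
  shows "norm_closed bop_alg S"
  unfolding norm_closed_def
proof (intro allI impI)
  fix s and x :: "'a \<Rightarrow>\<^sub>L 'a"
  assume s: "range s \<subseteq> S" and x: "x \<in> carrier bop_alg" and lim: "norm_lim bop_alg s x"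
  have "s n \<ominus>\<^bsub>bop_alg\<^esub> x = s n - x" for n using s x assms(2) by (intro bop_minus) auto
  hence "s \<longlonglongrightarrow> x"
    using lim by (simp add: norm_lim_def tendsto_norm_zero_iff LIM_zero_iff)
  thus "x \<in> S" using closed_sequentially[OF assms(1)] s by blast
qed

text \<open>All axioms, including those of a ring, are pulled back along \<open>\<rho>\<close>; completeness is closedness of the
  image. This yields at once that quotient norms satisfy the C*-identity, which otherwise requires
  approximate units.\<close>

lemma cstar_algebraI_isometric:
  fixes B :: "('b, 'n) cstar_alg_scheme" and \<rho> :: "'b \<Rightarrow> ('h::chilbert_space \<Rightarrow>\<^sub>L 'h)"
  assumes inj: "inj_on \<rho> (carrier B)" and image: "closed (\<rho> ` carrier B)"
    and bop: "\<And>x. x \<in> carrier B \<Longrightarrow> \<rho> x \<in> carrier bop_alg"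
    and zero: "\<zero>\<^bsub>B\<^esub> \<in> carrier B" "\<rho> \<zero>\<^bsub>B\<^esub> = 0"
    and one: "\<one>\<^bsub>B\<^esub> \<in> carrier B" "\<rho> \<one>\<^bsub>B\<^esub> = id_blinfun"
    and add: "\<And>x y. x \<in> carrier B \<Longrightarrow> y \<in> carrier B \<Longrightarrow> x \<oplus>\<^bsub>B\<^esub> y \<in> carrier B"
      "\<And>x y. x \<in> carrier B \<Longrightarrow> y \<in> carrier B \<Longrightarrow> \<rho> (x \<oplus>\<^bsub>B\<^esub> y) = \<rho> x + \<rho> y"
    and mult: "\<And>x y. x \<in> carrier B \<Longrightarrow> y \<in> carrier B \<Longrightarrow> x \<otimes>\<^bsub>B\<^esub> y \<in> carrier B"
      "\<And>x y. x \<in> carrier B \<Longrightarrow> y \<in> carrier B \<Longrightarrow> \<rho> (x \<otimes>\<^bsub>B\<^esub> y) = \<rho> x \<star> \<rho> y"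
    and scale: "\<And>c x. x \<in> carrier B \<Longrightarrow> cscale B c x \<in> carrier B"
      "\<And>c x. x \<in> carrier B \<Longrightarrow> \<rho> (cscale B c x) = cscale bop_alg c (\<rho> x)"
    and star: "\<And>x. x \<in> carrier B \<Longrightarrow> star B x \<in> carrier B"
      "\<And>x. x \<in> carrier B \<Longrightarrow> \<rho> (star B x) = (\<rho> x)\<^sup>\<dagger>"
    and norm: "\<And>x. x \<in> carrier B \<Longrightarrow> cnorm B x = norm (\<rho> x)"
  shows "cstar_algebra B"
proof -
  have eqI: "x = y" if "\<rho> x = \<rho> y" "x \<in> carrier B" "y \<in> carrier B" for x y
    using inj_onD[OF inj] that by blast
  note closed = zero(1) one(1) add(1) mult(1) scale(1) star(1)
  note rho = zero(2) one(2) add(2) mult(2) scale(2) star(2)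
  note op = bop blinfun.bilinear_simps blinfun_apply_cscale
  have "ring B"
  proof (rule ringI)
    show "abelian_group B"
    proof (rule abelian_groupI)
      fix x assume x: "x \<in> carrier B"
      have "cscale B (- 1) x \<oplus>\<^bsub>B\<^esub> x = \<zero>\<^bsub>B\<^esub>"
        by (rule eqI) (simp_all add: closed rho x, rule blinfun_eqI, simp add: op scaleC_minus_one)
      thus "\<exists>y\<in>carrier B. y \<oplus>\<^bsub>B\<^esub> x = \<zero>\<^bsub>B\<^esub>" using scale(1)[OF x] by blast
    qed (auto intro!: eqI simp: closed rho add_ac)
    show "monoid B"
      by (rule monoidI) (auto intro!: eqI simp: closed rho blinfun_compose_assoc)
  qed (auto intro!: eqI blinfun_eqI simp: closed rho op)
  then interpret ring B .
  have minus: "\<rho> (x \<ominus>\<^bsub>B\<^esub> y) = \<rho> x - \<rho> y" if "x \<in> carrier B" "y \<in> carrier B" for x y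
  proof -
    have "\<rho> (x \<ominus>\<^bsub>B\<^esub> y) + \<rho> y = \<rho> ((x \<ominus>\<^bsub>B\<^esub> y) \<oplus>\<^bsub>B\<^esub> y)" using that by (simp add: rho)
    also have "(x \<ominus>\<^bsub>B\<^esub> y) \<oplus>\<^bsub>B\<^esub> y = x" using that by (simp add: a_minus_def a_assoc l_neg)
    finally show ?thesis by (simp add: eq_diff_eq)
  qed
  have lin: "blinfun_apply (\<rho> x) (c *\<^sub>C v) = c *\<^sub>C blinfun_apply (\<rho> x) v" if "x \<in> carrier B" for x c v
    using bop[OF that] carrier_bop by blast
  show ?thesis
  proof
    fix s :: "nat \<Rightarrow> 'b"
    assume s: "range s \<subseteq> carrier B"
      and C: "\<forall>e>0. \<exists>N. \<forall>m\<ge>N. \<forall>n\<ge>N. cnorm B (s m \<ominus>\<^bsub>B\<^esub> s n) < e"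
    have sB: "s n \<in> carrier B" for n using s by blast
    have "cnorm B (s m \<ominus>\<^bsub>B\<^esub> s n) = dist (\<rho> (s m)) (\<rho> (s n))" for m n
      by (simp add: norm minus sB dist_norm)
    hence "Cauchy (\<lambda>n. \<rho> (s n))" using C unfolding Cauchy_def by simp
    then obtain L where L: "(\<lambda>n. \<rho> (s n)) \<longlonglongrightarrow> L" using Cauchy_convergent convergent_def by blast
    have "L \<in> \<rho> ` carrier B" by (rule closed_sequentially[OF image _ L]) (simp add: sB)
    then obtain x where x: "x \<in> carrier B" "L = \<rho> x" by blast
    have "norm_lim B s x"
      using L unfolding norm_lim_def x(2) by (simp add: norm minus sB x(1) tendsto_norm_zero_iff LIM_zero_iff)
    thus "\<exists>x\<in>carrier B. norm_lim B s x" using x by blast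
  next
    fix x assume x: "x \<in> carrier B"
    show "cnorm B x = 0 \<longleftrightarrow> x = \<zero>\<^bsub>B\<^esub>" using eqI[OF _ x zero(1)] by (auto simp: norm x rho closed)
    show "cscale B 1 x = x"
      by (rule eqI) (simp_all add: closed rho x, rule blinfun_eqI, simp add: op scaleC_one)
    show "cscale B (c + d) x = cscale B c x \<oplus>\<^bsub>B\<^esub> cscale B d x" for c d
      by (rule eqI) (simp_all add: closed rho x, rule blinfun_eqI, simp add: op scaleC_add_left)
    show "cscale B c (cscale B d x) = cscale B (c * d) x" for c d
      by (rule eqI) (simp_all add: closed rho x, rule blinfun_eqI, simp add: op scaleC_scaleC)
    show "star B (cscale B c x) = cscale B (cnj c) (star B x)" for c
      by (rule eqI) (simp_all add: closed rho x bop hadjoint_cscale)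
    show "star B (star B x) = x" by (rule eqI) (simp_all add: closed rho x bop)
    show "cnorm B (cscale B c x) = cmod c * cnorm B x" for c
      by (simp add: norm closed rho x norm_bop_cscale)
    show "cnorm B (star B x \<otimes>\<^bsub>B\<^esub> x) = (cnorm B x)\<^sup>2"
      by (simp add: norm closed rho x bop norm_hadjoint_compose)
  next
    fix x y assume x: "x \<in> carrier B" and y: "y \<in> carrier B"
    show "cscale B c (x \<oplus>\<^bsub>B\<^esub> y) = cscale B c x \<oplus>\<^bsub>B\<^esub> cscale B c y" for c
      by (rule eqI) (simp_all add: closed rho x y, rule blinfun_eqI, simp add: op scaleC_add_right)
    show "cscale B c x \<otimes>\<^bsub>B\<^esub> y = cscale B c (x \<otimes>\<^bsub>B\<^esub> y)" for c
      by (rule eqI) (simp_all add: closed rho x y, rule blinfun_eqI, simp add: op)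
    show "x \<otimes>\<^bsub>B\<^esub> cscale B c y = cscale B c (x \<otimes>\<^bsub>B\<^esub> y)" for c
      by (rule eqI) (simp_all add: closed rho x y, rule blinfun_eqI, simp add: op lin x)
    show "star B (x \<oplus>\<^bsub>B\<^esub> y) = star B x \<oplus>\<^bsub>B\<^esub> star B y"
      by (rule eqI) (simp_all add: closed rho x y bop hadjoint_add)
    show "star B (x \<otimes>\<^bsub>B\<^esub> y) = star B y \<otimes>\<^bsub>B\<^esub> star B x"
      by (rule eqI) (simp_all add: closed rho x y bop hadjoint_compose)
    show "cnorm B (x \<oplus>\<^bsub>B\<^esub> y) \<le> cnorm B x + cnorm B y"
      by (simp add: norm closed rho x y norm_triangle_ineq)
    show "cnorm B (x \<otimes>\<^bsub>B\<^esub> y) \<le> cnorm B x * cnorm B y"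
      by (simp add: norm closed rho x y norm_blinfun_compose)
  qed (simp_all add: closed norm)
qed

lemma star_hom_bopD:
  assumes "f \<in> star_hom A bop_alg" "x \<in> carrier A"
  shows "f x \<in> carrier bop_alg" "y \<in> carrier A \<Longrightarrow> f (x \<oplus>\<^bsub>A\<^esub> y) = f x + f y"
    "y \<in> carrier A \<Longrightarrow> f (x \<otimes>\<^bsub>A\<^esub> y) = f x \<star> f y"
    "f (cscale A c x) = cscale bop_alg c (f x)" "f (star A x) = (f x)\<^sup>\<dagger>"
  using assms by (auto simp: star_hom_def)

locale faithful_representation = cstar_algebra A
  for A :: "('a, 'm) cstar_alg_scheme" (structure)
    and \<pi> :: "'a \<Rightarrow> ('h::chilbert_space \<Rightarrow>\<^sub>L 'h)" +
  assumes representation: "\<pi> \<in> star_hom A bop_alg"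
    and nondegenerate: "closure (span {blinfun_apply (\<pi> a) h | a h. a \<in> carrier A}) = UNIV"
    and faithful: "inj_on \<pi> (carrier A)"
begin

lemmas pi_closed [simp] = star_hom_bopD(1)[OF representation]
  and pi_add = star_hom_bopD(2)[OF representation]
  and pi_mult = star_hom_bopD(3)[OF representation]
  and pi_cscale = star_hom_bopD(4)[OF representation]
  and pi_star = star_hom_bopD(5)[OF representation]

lemma pi_zero: "\<pi> \<zero> = 0"
  using pi_add[of \<zero> \<zero>] by simp

lemma pi_minus:
  assumes "x \<in> carrier A" "y \<in> carrier A"
  shows "\<pi> (x \<ominus> y) = \<pi> x - \<pi> y"
proof -
  have "\<pi> (x \<ominus> y) + \<pi> y = \<pi> ((x \<ominus> y) \<oplus> y)" using assms by (simp add: pi_add)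
  also have "(x \<ominus> y) \<oplus> y = x" using assms by (simp add: a_minus_def a_assoc l_neg)
  finally show ?thesis by (simp add: eq_diff_eq)
qed

lemma pi_eq_iff: "x \<in> carrier A \<Longrightarrow> y \<in> carrier A \<Longrightarrow> \<pi> x = \<pi> y \<longleftrightarrow> x = y"
  using faithful by (auto dest: inj_onD)

text \<open>The operator \<open>\<pi> \<one>\<close> fixes every vector \<open>\<pi>(a)h\<close>, and these span a dense subspace.\<close>

lemma pi_one: "\<pi> \<one> = id_blinfun"
proof (rule blinfun_eqI)
  fix v
  let ?F = "{w. blinfun_apply (\<pi> \<one>) w = w}"
  have "blinfun_apply (\<pi> \<one>) (blinfun_apply (\<pi> a) h) = blinfun_apply (\<pi> a) h" if "a \<in> carrier A" for a h
    using that pi_mult[of \<one> a] by (metis blinfun_apply_blinfun_compose l_one one_closed)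
  hence "{blinfun_apply (\<pi> a) h | a h. a \<in> carrier A} \<subseteq> ?F" by blast
  moreover have "subspace ?F"
    by (auto simp: subspace_def blinfun.bilinear_simps)
  ultimately have "span {blinfun_apply (\<pi> a) h | a h. a \<in> carrier A} \<subseteq> ?F" by (rule span_minimal)
  moreover have "closed ?F"
    by (intro closed_Collect_eq continuous_intros blinfun.continuous_on)
  ultimately have "UNIV \<subseteq> ?F" unfolding nondegenerate[symmetric] by (rule closure_minimal)
  thus "blinfun_apply (\<pi> \<one>) v = blinfun_apply id_blinfun v" by auto
qed

lemma image_star_algebra: "operator_star_algebra (\<pi> ` carrier A)"
proof
  show "id_blinfun \<in> \<pi> ` carrier A" using pi_one by (metis imageI one_closed)
  fix x assume "x \<in> \<pi> ` carrier A"
  then obtain a where a: "a \<in> carrier A" "x = \<pi> a" by blast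
  show "cscale bop_alg c x \<in> \<pi> ` carrier A" for c
    using a cscale_closed by (simp flip: pi_cscale)
  show "x\<^sup>\<dagger> \<in> \<pi> ` carrier A" using a star_closed by (simp flip: pi_star)
  fix y assume "y \<in> \<pi> ` carrier A"
  then obtain b where b: "b \<in> carrier A" "y = \<pi> b" by blast
  show "x + y \<in> \<pi> ` carrier A" using a b by (simp flip: pi_add)
  show "x \<star> y \<in> \<pi> ` carrier A" using a b by (simp flip: pi_mult)
qed auto

text \<open>The norm of \<open>A\<close>, transported to the image of \<open>\<pi>\<close>, is a complete C*-norm.\<close>

theorem cnorm_eq_norm:
  assumes "a \<in> carrier A"
  shows "cnorm A a = norm (\<pi> a)"
proof -
  interpret operator_star_algebra "\<pi> ` carrier A" by (rule image_star_algebra)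
  define N where "N T = cnorm A (inv_into (carrier A) \<pi> T)" for T
  have N: "N (\<pi> x) = cnorm A x" if "x \<in> carrier A" for x
    by (simp add: N_def faithful that)
  interpret complete_cstar_norm "\<pi> ` carrier A" N
  proof
    fix s :: "nat \<Rightarrow> 'h \<Rightarrow>\<^sub>L 'h"
    assume "range s \<subseteq> \<pi> ` carrier A"
      and C: "\<forall>e>0. \<exists>M. \<forall>m\<ge>M. \<forall>n\<ge>M. N (s m - s n) < e"
    hence "\<forall>n. \<exists>x. x \<in> carrier A \<and> s n = \<pi> x" by blast
    then obtain a where a: "\<And>n. a n \<in> carrier A" "\<And>n. s n = \<pi> (a n)" by metis
    have N_s: "N (s n - \<pi> x) = cnorm A (a n \<ominus> x)" if "x \<in> carrier A" for n x
      by (simp add: a that N flip: pi_minus)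
    have diff_eq: "N (s m - s n) = cnorm A (a m \<ominus> a n)" for m n
      using N_s[OF a(1), of m n] by (simp only: a(2)[of n])
    have "\<exists>x\<in>carrier A. norm_lim A a x"
    proof (rule complete)
      show "range a \<subseteq> carrier A" using a(1) by blast
      show "\<forall>e>0. \<exists>M. \<forall>m\<ge>M. \<forall>n\<ge>M. cnorm A (a m \<ominus> a n) < e"
        using C by (simp only: diff_eq)
    qed
    then obtain x where x: "x \<in> carrier A" "norm_lim A a x" by blast
    hence "(\<lambda>n. N (s n - \<pi> x)) \<longlonglongrightarrow> 0" by (simp add: N_s norm_lim_def)
    thus "\<exists>x\<in>\<pi> ` carrier A. (\<lambda>n. N (s n - x)) \<longlonglongrightarrow> 0" using x by blast
  next
    fix x assume "x \<in> \<pi> ` carrier A"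
    then obtain a where a: "a \<in> carrier A" "x = \<pi> a" by blast
    show "0 \<le> N x" using a by (simp add: N cnorm_ge_zero)
    show "N x = 0 \<longleftrightarrow> x = 0" using a pi_eq_iff[of a \<zero>] by (simp add: N cnorm_eq_zero pi_zero)
    show "N (cscale bop_alg c x) = cmod c * N x" for c
      using a by (simp add: N cnorm_cscale cscale_closed flip: pi_cscale)
    show "N (x\<^sup>\<dagger> \<star> x) = (N x)\<^sup>2"
      using a by (simp add: N cstar_identity star_closed flip: pi_star pi_mult)
    fix y assume "y \<in> \<pi> ` carrier A"
    then obtain b where b: "b \<in> carrier A" "y = \<pi> b" by blast
    show "N (x + y) \<le> N x + N y" using a b by (simp add: N cnorm_triangle flip: pi_add)
    show "N (x \<star> y) \<le> N x * N y" using a b by (simp add: N cnorm_mult flip: pi_mult)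
  qed
  show ?thesis using N_eq_norm[of "\<pi> a"] N[OF assms] assms by simp
qed

lemma closed_image: "closed (\<pi> ` carrier A)"
proof (unfold closed_sequential_limits, intro allI impI)
  fix s L assume s: "(\<forall>n. s n \<in> \<pi> ` carrier A) \<and> s \<longlonglongrightarrow> L"
  hence "\<forall>n. \<exists>x. x \<in> carrier A \<and> s n = \<pi> x" by blast
  then obtain a where a: "\<And>n. a n \<in> carrier A" "\<And>n. s n = \<pi> (a n)" by metis
  have dist: "dist (s m) (s n) = cnorm A (a m \<ominus> a n)" for m n
    by (simp add: a dist_norm cnorm_eq_norm pi_minus)
  have "Cauchy s" using s LIMSEQ_imp_Cauchy by blast
  hence "\<exists>x\<in>carrier A. norm_lim A a x"
    unfolding Cauchy_def dist using a(1) by (intro complete) blast+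
  then obtain x where x: "x \<in> carrier A" "norm_lim A a x" by blast
  hence "(\<lambda>n. norm (s n - \<pi> x)) \<longlonglongrightarrow> 0"
    by (simp add: norm_lim_def cnorm_eq_norm pi_minus a)
  hence "s \<longlonglongrightarrow> \<pi> x" by (simp add: tendsto_norm_zero_iff LIM_zero_iff)
  hence "L = \<pi> x" using s by (intro LIMSEQ_unique[of s]) simp_all
  thus "L \<in> \<pi> ` carrier A" using x by blast
qed

lemma closed_image_star_algebra: "closed_operator_star_algebra (\<pi> ` carrier A)"
  using image_star_algebra closed_image
  by (simp add: closed_operator_star_algebra_def closed_operator_star_algebra_axioms_def)

end

section \<open>Quotients as compressions\<close>

lemma cstar_quotient_sel:
  "carrier (cstar_quotient A I) = a_rcosets\<^bsub>A\<^esub> I"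
  "mult (cstar_quotient A I) = rcoset_mult A I"
  "one (cstar_quotient A I) = I +>\<^bsub>A\<^esub> \<one>\<^bsub>A\<^esub>"
  "zero (cstar_quotient A I) = I"
  "add (cstar_quotient A I) = set_add A"
  "cscale (cstar_quotient A I) c X = (\<Union>x\<in>X. I +>\<^bsub>A\<^esub> cscale A c x)"
  "star (cstar_quotient A I) X = (\<Union>x\<in>X. I +>\<^bsub>A\<^esub> star A x)"
  "cnorm (cstar_quotient A I) X = Inf (cnorm A ` X)"
  by (simp_all add: cstar_quotient_def ring.defs cstar_alg.defs FactRing_def)

lemma cstar_sum_sel:
  "carrier (cstar_sum A B) = carrier A \<times> carrier B"
  "mult (cstar_sum A B) (x, y) (x', y') = (x \<otimes>\<^bsub>A\<^esub> x', y \<otimes>\<^bsub>B\<^esub> y')"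
  "one (cstar_sum A B) = (\<one>\<^bsub>A\<^esub>, \<one>\<^bsub>B\<^esub>)"
  "zero (cstar_sum A B) = (\<zero>\<^bsub>A\<^esub>, \<zero>\<^bsub>B\<^esub>)"
  "add (cstar_sum A B) (x, y) (x', y') = (x \<oplus>\<^bsub>A\<^esub> x', y \<oplus>\<^bsub>B\<^esub> y')"
  "cscale (cstar_sum A B) c (x, y) = (cscale A c x, cscale B c y)"
  "star (cstar_sum A B) (x, y) = (star A x, star B y)"
  "cnorm (cstar_sum A B) (x, y) = max (cnorm A x) (cnorm B y)"
  by (simp_all add: cstar_sum_def ring.defs cstar_alg.defs RDirProd_def DirProd_def monoid.defs)

locale compressed_representation = faithful_representation A \<pi>
  for A :: "('a, 'm) cstar_alg_scheme" (structure)
    and \<pi> :: "'a \<Rightarrow> ('h::chilbert_space \<Rightarrow>\<^sub>L 'h)" +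
  fixes q :: "'h \<Rightarrow>\<^sub>L 'h"
  assumes proj: "projection q"
    and commutes: "a \<in> carrier A \<Longrightarrow> q \<star> \<pi> a = \<pi> a \<star> q"
begin

sublocale comp: commuting_projection "\<pi> ` carrier A" q
proof (rule commuting_projection.intro[OF closed_image_star_algebra])
  show "commuting_projection_axioms (\<pi> ` carrier A) q"
    by unfold_locales (use proj commutes in auto)
qed

definition compression_kernel :: "'a set" where
  "compression_kernel = {a \<in> carrier A. q \<star> \<pi> a = 0}"

abbreviation "K \<equiv> compression_kernel"

lemma compress_add: "a \<in> carrier A \<Longrightarrow> b \<in> carrier A \<Longrightarrow> q \<star> \<pi> (a \<oplus> b) = q \<star> \<pi> a + q \<star> \<pi> b"
  by (simp add: pi_add bounded_bilinear.add_right[OF bounded_bilinear_blinfun_compose])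

lemma compress_minus: "a \<in> carrier A \<Longrightarrow> b \<in> carrier A \<Longrightarrow> q \<star> \<pi> (a \<ominus> b) = q \<star> \<pi> a - q \<star> \<pi> b"
  by (simp add: pi_minus bounded_bilinear.diff_right[OF bounded_bilinear_blinfun_compose])

lemma compress_mult: "a \<in> carrier A \<Longrightarrow> b \<in> carrier A \<Longrightarrow> q \<star> \<pi> (a \<otimes> b) = (q \<star> \<pi> a) \<star> (q \<star> \<pi> b)"
  by (rule blinfun_eqI)
    (simp add: pi_mult compose_commuteD[OF commutes, symmetric] projectionD(4)[OF proj])

lemma compress_cscale: "a \<in> carrier A \<Longrightarrow> q \<star> \<pi> (cscale A c a) = cscale bop_alg c (q \<star> \<pi> a)"
  using projectionD(1)[OF proj]
  by (intro blinfun_eqI) (simp add: pi_cscale blinfun_apply_cscale carrier_bop)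

lemma compress_star: "a \<in> carrier A \<Longrightarrow> q \<star> \<pi> (star A a) = (q \<star> \<pi> a)\<^sup>\<dagger>"
  using projectionD(1,2)[OF proj] commutes[OF star_closed, of a]
  by (simp add: pi_star hadjoint_compose)

lemma kernel_ideal: "ideal K A"
proof (rule idealI)
  show "subgroup K (add_monoid A)"
  proof (rule group.subgroupI)
    show "group (add_monoid A)" by (rule a_group)
    show "K \<noteq> {}" using pi_zero by (auto simp: compression_kernel_def)
    fix a assume a: "a \<in> K"
    have "\<zero> \<ominus> a \<in> K" using a by (simp add: compression_kernel_def compress_minus pi_zero)
    moreover have "\<zero> \<ominus> a = \<ominus> a" using a by (simp add: compression_kernel_def a_minus_def)
    ultimately have "\<ominus> a \<in> K" by simp
    thus "inv\<^bsub>add_monoid A\<^esub> a \<in> K" unfolding a_inv_def .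
  qed (auto simp: compression_kernel_def compress_add)
qed (auto simp: compression_kernel_def compress_mult ring_axioms)

lemma kernel_closed: "norm_closed A K"
  unfolding norm_closed_def
proof (intro allI impI)
  fix s x
  assume s: "range s \<subseteq> K" and x: "x \<in> carrier A" and lim: "norm_lim A s x"
  have "s n \<in> K" for n using s by blast
  hence sA: "s n \<in> carrier A" "q \<star> \<pi> (s n) = 0" for n by (simp_all add: compression_kernel_def)
  have "(\<lambda>n. norm (\<pi> (s n) - \<pi> x)) \<longlonglongrightarrow> 0"
    using lim by (simp add: norm_lim_def cnorm_eq_norm pi_minus sA(1) x)
  hence "(\<lambda>n. \<pi> (s n)) \<longlonglongrightarrow> \<pi> x" by (simp add: tendsto_norm_zero_iff LIM_zero_iff)
  hence "(\<lambda>n. q \<star> \<pi> (s n)) \<longlonglongrightarrow> q \<star> \<pi> x"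
    by (rule bounded_bilinear.tendsto[OF bounded_bilinear_blinfun_compose tendsto_const])
  hence "q \<star> \<pi> x = 0" unfolding sA(2) by (simp add: LIMSEQ_const_iff)
  thus "x \<in> K" using x by (simp add: compression_kernel_def)
qed

lemma coset:
  assumes a: "a \<in> carrier A"
  shows "K +> a = {x \<in> carrier A. q \<star> \<pi> x = q \<star> \<pi> a}"
proof (intro equalityI subsetI)
  fix x assume "x \<in> K +> a"
  thus "x \<in> {x \<in> carrier A. q \<star> \<pi> x = q \<star> \<pi> a}"
    using a by (auto simp: a_r_coset_def' compression_kernel_def compress_add)
next
  fix x assume "x \<in> {x \<in> carrier A. q \<star> \<pi> x = q \<star> \<pi> a}"
  hence x: "x \<in> carrier A" "q \<star> \<pi> x = q \<star> \<pi> a" by auto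
  have "x \<ominus> a \<in> K" using x a by (simp add: compression_kernel_def compress_minus)
  moreover have "x = (x \<ominus> a) \<oplus> a" using x a by (simp add: a_minus_def a_assoc l_neg)
  ultimately show "x \<in> K +> a" unfolding a_r_coset_def' by blast
qed

lemma coset_eq_iff:
  assumes "a \<in> carrier A" "b \<in> carrier A"
  shows "K +> a = K +> b \<longleftrightarrow> q \<star> \<pi> a = q \<star> \<pi> b"
  using assms by (auto simp: coset)

lemma UN_coset:
  assumes a: "a \<in> carrier A" and f: "\<And>x. x \<in> carrier A \<Longrightarrow> q \<star> \<pi> x = q \<star> \<pi> a \<Longrightarrow> F x = F a"
  shows "(\<Union>x\<in>K +> a. F x) = F a"
proof -
  have "a \<in> K +> a" using a by (simp add: coset)
  hence ne: "K +> a \<noteq> {}" by blast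
  have "(\<Union>x\<in>K +> a. F x) = (\<Union>x\<in>K +> a. F a)"
  proof (rule SUP_cong[OF refl])
    fix x assume "x \<in> K +> a"
    hence "x \<in> carrier A" "q \<star> \<pi> x = q \<star> \<pi> a" by (simp_all add: coset[OF a])
    thus "F x = F a" by (rule f)
  qed
  thus ?thesis using ne by simp
qed

text \<open>By \<open>coset\<close> the compression is constant on each coset of its kernel, so any representative will do.\<close>

definition compress_coset :: "'a set \<Rightarrow> ('h \<Rightarrow>\<^sub>L 'h)" where
  "compress_coset X = q \<star> \<pi> (SOME a. a \<in> X)"

lemma compress_coset_eq [simp]:
  assumes "a \<in> carrier A"
  shows "compress_coset (K +> a) = q \<star> \<pi> a"
proof -
  have "(SOME x. x \<in> K +> a) \<in> K +> a"
    by (rule someI[of _ a]) (simp add: coset assms)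
  thus ?thesis using assms by (simp add: compress_coset_def coset)
qed

abbreviation "Q \<equiv> cstar_quotient A K"

lemma quotient_carrier: "carrier Q = (+>) K ` carrier A"
  unfolding cstar_quotient_sel A_RCOSETS_def' by (rule UNION_singleton_eq_range)

lemma quotient_add: "a \<in> carrier A \<Longrightarrow> b \<in> carrier A \<Longrightarrow> (K +> a) \<oplus>\<^bsub>Q\<^esub> (K +> b) = K +> (a \<oplus> b)"
  by (simp add: cstar_quotient_sel ideal.a_rcos_sum[OF kernel_ideal])

lemma quotient_mult: "a \<in> carrier A \<Longrightarrow> b \<in> carrier A \<Longrightarrow> (K +> a) \<otimes>\<^bsub>Q\<^esub> (K +> b) = K +> (a \<otimes> b)"
  by (simp add: cstar_quotient_sel ideal.rcoset_mult_add[OF kernel_ideal])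

lemma quotient_zero: "\<zero>\<^bsub>Q\<^esub> = K +> \<zero>"
proof -
  have "K \<subseteq> carrier A" by (auto simp: compression_kernel_def)
  thus ?thesis by (simp add: cstar_quotient_sel)
qed

lemma quotient_one: "\<one>\<^bsub>Q\<^esub> = K +> \<one>"
  by (simp add: cstar_quotient_sel)

lemma quotient_cscale: "a \<in> carrier A \<Longrightarrow> cscale Q c (K +> a) = K +> cscale A c a"
  unfolding cstar_quotient_sel
  by (rule UN_coset) (simp_all add: coset_eq_iff cscale_closed compress_cscale)

lemma quotient_star: "a \<in> carrier A \<Longrightarrow> star Q (K +> a) = K +> star A a"
  unfolding cstar_quotient_sel
  by (rule UN_coset) (simp_all add: coset_eq_iff star_closed compress_star)

lemma quotient_cnorm:
  assumes a: "a \<in> carrier A"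
  shows "cnorm Q (K +> a) = norm (q \<star> \<pi> a)"
proof -
  have "cnorm A ` (K +> a) = {norm (k + \<pi> a) |k. k \<in> \<pi> ` carrier A \<and> q \<star> k = 0}"
  proof (intro equalityI subsetI)
    fix r assume "r \<in> cnorm A ` (K +> a)"
    then obtain x where x: "x \<in> carrier A" "q \<star> \<pi> x = q \<star> \<pi> a" "r = norm (\<pi> x)"
      using a by (auto simp: coset cnorm_eq_norm)
    have "r = norm (\<pi> (x \<ominus> a) + \<pi> a)" "q \<star> \<pi> (x \<ominus> a) = 0"
      using x a by (simp_all add: compress_minus) (simp add: pi_minus)
    thus "r \<in> {norm (k + \<pi> a) |k. k \<in> \<pi> ` carrier A \<and> q \<star> k = 0}" using x a by blast
  next
    fix r assume "r \<in> {norm (k + \<pi> a) |k. k \<in> \<pi> ` carrier A \<and> q \<star> k = 0}"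
    then obtain x where x: "x \<in> carrier A" "q \<star> \<pi> x = 0" "r = norm (\<pi> x + \<pi> a)" by blast
    have "r = cnorm A (x \<oplus> a)" "x \<oplus> a \<in> K +> a"
      using x a by (simp_all add: cnorm_eq_norm pi_add coset)
        (simp add: bounded_bilinear.add_right[OF bounded_bilinear_blinfun_compose])
    thus "r \<in> cnorm A ` (K +> a)" by blast
  qed
  thus ?thesis using comp.compressed_norm[of "\<pi> a"] a by (simp add: cstar_quotient_sel)
qed

end



section \<open>Partial isometries\<close>

text \<open>Isometry is assumed only on the orthogonal complement of the kernel, which contains the range of
  \<open>U\<^sup>\<dagger>\<close>. Hence \<open>R = UU\<^sup>\<dagger>\<close> and \<open>R\<^sup>2\<close> have the same quadratic form and agree by polarization; from \<open>R\<^sup>2 = R\<close>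
  follows \<open>U\<^sup>\<dagger>R = U\<^sup>\<dagger>\<close>.\<close>

lemma partial_isometryD:
  assumes "partial_isometry U"
  shows "U \<in> carrier bop_alg" "projection (U\<^sup>\<dagger> \<star> U)" "U \<star> (U\<^sup>\<dagger> \<star> U) = U"
proof -
  show U: "U \<in> carrier bop_alg" using assms by (simp add: partial_isometry_def)
  note adj = cinner_hadjoint_right[OF U] cinner_hadjoint_left[OF U]
  define R where "R = U \<star> U\<^sup>\<dagger>"
  define E where "E = R \<star> R - R"
  have R: "R \<in> carrier bop_alg" "R\<^sup>\<dagger> = R" using U by (simp_all add: R_def hadjoint_compose)
  have Rsym: "cinner (blinfun_apply R v) w = cinner v (blinfun_apply R w)" for v w
    using cinner_hadjoint_right[OF R(1), of v w] by (simp add: R(2))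
  have iso: "norm (blinfun_apply U (blinfun_apply (U\<^sup>\<dagger>) v)) = norm (blinfun_apply (U\<^sup>\<dagger>) v)" for v
    using assms unfolding partial_isometry_def by (simp add: adj)
  have quad: "cinner (blinfun_apply R (blinfun_apply R v)) v = cinner (blinfun_apply R v) v" for v
  proof -
    have "cinner (blinfun_apply R (blinfun_apply R v)) v = cinner (blinfun_apply R v) (blinfun_apply R v)"
      by (simp add: Rsym)
    also have "\<dots> = of_real ((norm (blinfun_apply (U\<^sup>\<dagger>) v))\<^sup>2)"
      by (simp add: cinner_self R_def iso)
    also have "\<dots> = cinner (blinfun_apply R v) v"
      by (simp add: R_def adj(1)[symmetric] cinner_self)
    finally show ?thesis .
  qed
  have Eq: "cinner (blinfun_apply E v) v = 0" for v
    by (simp add: E_def blinfun.bilinear_simps cinner_diff_left quad)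
  have Esym: "cinner (blinfun_apply E v) w = cinner v (blinfun_apply E w)" for v w
    by (simp add: E_def blinfun.bilinear_simps cinner_simps Rsym)
  have "blinfun_apply E v = 0" for v
  proof -
    let ?w = "blinfun_apply E v"
    \<comment> \<open>expanding the vanishing form at \<open>v + E v\<close> leaves twice the squared norm of \<open>E v\<close>\<close>
    have "cinner (blinfun_apply E (v + ?w)) (v + ?w) = 2 * cinner ?w ?w"
      using Eq[of v] Eq[of ?w] by (simp add: blinfun.bilinear_simps cinner_simps Esym[of ?w v])
    thus ?thesis using Eq[of "v + ?w"] by (simp add: cinner_eq_zero)
  qed
  hence RR: "blinfun_apply R (blinfun_apply R v) = blinfun_apply R v" for v
    by (simp add: E_def blinfun.bilinear_simps)
  have adjoint_id: "blinfun_apply (U\<^sup>\<dagger>) (blinfun_apply R v) = blinfun_apply (U\<^sup>\<dagger>) v" for v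
  proof -
    let ?z = "blinfun_apply (U\<^sup>\<dagger>) (blinfun_apply R v - v)"
    have "cinner ?z ?z = cinner (blinfun_apply R (blinfun_apply R v - v)) (blinfun_apply R v - v)"
      by (simp add: R_def adj(1)[symmetric])
    also have "\<dots> = 0" by (simp add: blinfun.bilinear_simps RR)
    finally show ?thesis by (simp add: cinner_eq_zero blinfun.bilinear_simps)
  qed
  have 4: "(U\<^sup>\<dagger> \<star> U) \<star> U\<^sup>\<dagger> = U\<^sup>\<dagger>"
    by (rule blinfun_eqI) (use adjoint_id in \<open>simp add: R_def\<close>)
  show 3: "U \<star> (U\<^sup>\<dagger> \<star> U) = U"
    using arg_cong[OF 4, of hadjoint] U by (simp add: hadjoint_compose)
  show "projection (U\<^sup>\<dagger> \<star> U)"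
    using U 3 by (simp add: projection_def hadjoint_compose) (metis blinfun_compose_assoc)
qed

section \<open>The extension associated with a covariant representation\<close>

lemma covariant_representation_faithful:
  assumes "covariant_representation A \<delta> \<pi> U"
  shows "faithful_representation A \<pi>"
proof -
  interpret covariant_representation A \<delta> \<pi> U by fact
  show ?thesis by unfold_locales (rule representation nondegenerate faithful)+
qed

context covariant_representation
begin

sublocale rep: faithful_representation A \<pi>
  by (rule covariant_representation_faithful) unfold_locales

abbreviation "P \<equiv> U\<^sup>\<dagger> \<star> U"
abbreviation "P' \<equiv> id_blinfun - U\<^sup>\<dagger> \<star> U"

lemmas U_bop [simp] = partial_isometryD(1)[OF partial_isometry]
  and P_projection = partial_isometryD(2)[OF partial_isometry]
  and UP = partial_isometryD(3)[OF partial_isometry]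

lemma P_commutes: "a \<in> carrier A \<Longrightarrow> P \<star> \<pi> a = \<pi> a \<star> P"
  using initial_projection_commutes by (auto simp: commutant_def)

sublocale init: compressed_representation A \<pi> P
  by unfold_locales (rule P_projection P_commutes; assumption)+

sublocale fin: compressed_representation A \<pi> P'
proof unfold_locales
  show "projection P'" by (rule projection_complement[OF P_projection])
  show "P' \<star> \<pi> a = \<pi> a \<star> P'" if "a \<in> carrier A" for a
    by (rule blinfun_eqI) (simp add: blinfun.bilinear_simps compose_commuteD[OF P_commutes[OF that], simplified])
qed

text \<open>One recovers \<open>P T\<close> from \<open>U T U\<^sup>\<dagger>\<close> as \<open>U\<^sup>\<dagger> (U T U\<^sup>\<dagger>) U\<close>.\<close>

lemma conj_eq_zero_iff:
  assumes T: "P \<star> T = T \<star> P"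
  shows "U \<star> T \<star> U\<^sup>\<dagger> = 0 \<longleftrightarrow> P \<star> T = 0"
proof
  assume "U \<star> T \<star> U\<^sup>\<dagger> = 0"
  have "P \<star> T = (P \<star> P) \<star> T" using projectionD(3)[OF P_projection] by simp
  also have "\<dots> = P \<star> (T \<star> P)" using T by (simp add: blinfun_compose_assoc)
  also have "\<dots> = U\<^sup>\<dagger> \<star> (U \<star> T \<star> U\<^sup>\<dagger>) \<star> U" by (simp add: blinfun_compose_assoc)
  finally show "P \<star> T = 0" using \<open>U \<star> T \<star> U\<^sup>\<dagger> = 0\<close> by simp
next
  assume "P \<star> T = 0"
  have "U \<star> T \<star> U\<^sup>\<dagger> = U \<star> (P \<star> T) \<star> U\<^sup>\<dagger>" using UP by (simp flip: blinfun_compose_assoc)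
  thus "U \<star> T \<star> U\<^sup>\<dagger> = 0" using \<open>P \<star> T = 0\<close> by simp
qed

lemma delta_closed [simp]: "a \<in> carrier A \<Longrightarrow> \<delta> a \<in> carrier A"
  using star_endo by (auto simp: star_hom_def)

lemma kernel_delta: "init.K = a_kernel A A \<delta>"
proof -
  have "P \<star> \<pi> a = 0 \<longleftrightarrow> \<delta> a = \<zero>" if a: "a \<in> carrier A" for a
    using conj_eq_zero_iff[OF P_commutes[OF a]] covariance[OF a] a rep.pi_eq_iff[of "\<delta> a" \<zero>]
    by (simp add: rep.pi_zero)
  thus ?thesis by (auto simp: init.compression_kernel_def a_kernel_def')
qed

lemma kernels_disjoint: "init.K \<inter> fin.K = {\<zero>}"
proof (intro equalityI subsetI)
  fix a assume "a \<in> init.K \<inter> fin.K"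
  hence a: "a \<in> carrier A" "P \<star> \<pi> a = 0" "P' \<star> \<pi> a = 0"
    by (auto simp: init.compression_kernel_def fin.compression_kernel_def)
  have "\<pi> a = P \<star> \<pi> a + P' \<star> \<pi> a" by (rule blinfun_eqI) (simp add: blinfun.bilinear_simps)
  hence "\<pi> a = 0" using a by simp
  thus "a \<in> {\<zero>}" using a rep.pi_eq_iff[of a \<zero>] by (simp add: rep.pi_zero)
qed (simp add: init.compression_kernel_def fin.compression_kernel_def rep.pi_zero)

abbreviation "B \<equiv> ext_alg A \<delta> fin.K"
abbreviation "\<delta>B \<equiv> ext_endo A \<delta> fin.K"
abbreviation elem :: "'a \<Rightarrow> 'a \<Rightarrow> 'a set \<times> 'a set" where
  "elem a b \<equiv> (init.K +> a, fin.K +> b)"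

definition ext_rep :: "'a set \<times> 'a set \<Rightarrow> ('h \<Rightarrow>\<^sub>L 'h)" where
  "ext_rep x = init.compress_coset (fst x) + fin.compress_coset (snd x)"

lemma ext_rep_elem:
  "a \<in> carrier A \<Longrightarrow> b \<in> carrier A \<Longrightarrow> ext_rep (elem a b) = P \<star> \<pi> a + P' \<star> \<pi> b"
  by (simp add: ext_rep_def)

lemma B_eq: "B = cstar_sum init.Q fin.Q"
  by (simp add: ext_alg_def kernel_delta)

lemma B_carrier: "x \<in> carrier B \<longleftrightarrow> (\<exists>a\<in>carrier A. \<exists>b\<in>carrier A. x = elem a b)"
  unfolding B_eq by (auto simp: cstar_sum_sel init.quotient_carrier fin.quotient_carrier)

lemma elem_closed [simp]: "a \<in> carrier A \<Longrightarrow> b \<in> carrier A \<Longrightarrow> elem a b \<in> carrier B"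
  by (auto simp: B_carrier)

lemma B_ops:
  assumes "a \<in> carrier A" "b \<in> carrier A"
  shows "c \<in> carrier A \<Longrightarrow> d \<in> carrier A \<Longrightarrow> elem a b \<oplus>\<^bsub>B\<^esub> elem c d = elem (a \<oplus> c) (b \<oplus> d)"
    "c \<in> carrier A \<Longrightarrow> d \<in> carrier A \<Longrightarrow> elem a b \<otimes>\<^bsub>B\<^esub> elem c d = elem (a \<otimes> c) (b \<otimes> d)"
    "cscale B z (elem a b) = elem (cscale A z a) (cscale A z b)"
    "star B (elem a b) = elem (star A a) (star A b)"
    "cnorm B (elem a b) = max (norm (P \<star> \<pi> a)) (norm (P' \<star> \<pi> b))"
  unfolding B_eq cstar_sum_sel using assms
  by (simp_all add: init.quotient_add fin.quotient_add init.quotient_mult fin.quotient_mult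
      init.quotient_cscale fin.quotient_cscale init.quotient_star fin.quotient_star
      init.quotient_cnorm fin.quotient_cnorm)

lemma B_units: "\<zero>\<^bsub>B\<^esub> = elem \<zero> \<zero>" "\<one>\<^bsub>B\<^esub> = elem \<one> \<one>"
  by (simp_all add: B_eq cstar_sum_sel init.quotient_zero fin.quotient_zero init.quotient_one fin.quotient_one)

lemma P_ext_rep:
  assumes "a \<in> carrier A" "b \<in> carrier A"
  shows "P \<star> ext_rep (elem a b) = P \<star> \<pi> a" "P' \<star> ext_rep (elem a b) = P' \<star> \<pi> b"
  using init.comp.compress_sum[of "\<pi> a" "\<pi> b"] assms by (simp_all add: ext_rep_elem)

lemma ext_rep_ops:
  assumes x: "x \<in> carrier B"
  shows "ext_rep x \<in> carrier bop_alg"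
    "y \<in> carrier B \<Longrightarrow> ext_rep (x \<oplus>\<^bsub>B\<^esub> y) = ext_rep x + ext_rep y"
    "y \<in> carrier B \<Longrightarrow> ext_rep (x \<otimes>\<^bsub>B\<^esub> y) = ext_rep x \<star> ext_rep y"
    "ext_rep (cscale B c x) = cscale bop_alg c (ext_rep x)"
    "ext_rep (star B x) = (ext_rep x)\<^sup>\<dagger>"
    "cnorm B x = norm (ext_rep x)"
    "P \<star> ext_rep x = ext_rep x \<star> P"
proof -
  obtain a b where a: "a \<in> carrier A" "b \<in> carrier A" "x = elem a b" using x B_carrier by auto
  note P = projectionD(1,2)[OF init.proj] and P' = projectionD(1,2)[OF fin.proj]
  show "ext_rep x \<in> carrier bop_alg" using a P P' by (simp add: ext_rep_elem)
  show "ext_rep (cscale B c x) = cscale bop_alg c (ext_rep x)"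
    using a by (simp add: B_ops ext_rep_elem cscale_closed init.compress_cscale fin.compress_cscale)
      (rule blinfun_eqI, simp add: blinfun_apply_cscale blinfun.add_left scaleC_add_right)
  show "ext_rep (star B x) = (ext_rep x)\<^sup>\<dagger>"
    using a P P' by (simp add: B_ops ext_rep_elem star_closed init.compress_star fin.compress_star hadjoint_add)
  show "cnorm B x = norm (ext_rep x)"
    using a init.comp.norm_compress_sum[of "\<pi> a" "\<pi> b"] by (simp add: B_ops ext_rep_elem)
  show "P \<star> ext_rep x = ext_rep x \<star> P"
    unfolding a(3) P_ext_rep[OF a(1,2)] unfolding ext_rep_elem[OF a(1,2)]
    by (rule blinfun_eqI)
      (simp add: blinfun.bilinear_simps projectionD(4)[OF P_projection, simplified]
        compose_commuteD[OF P_commutes, simplified, symmetric] a)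
  assume "y \<in> carrier B"
  then obtain c d where c: "c \<in> carrier A" "d \<in> carrier A" "y = elem c d" using B_carrier by auto
  show "ext_rep (x \<oplus>\<^bsub>B\<^esub> y) = ext_rep x + ext_rep y"
    using a c by (simp add: B_ops ext_rep_elem init.compress_add fin.compress_add)
  have "ext_rep x \<star> ext_rep y = P \<star> (ext_rep x \<star> ext_rep y) + P' \<star> (ext_rep x \<star> ext_rep y)"
    by (rule blinfun_eqI) (simp add: blinfun.bilinear_simps)
  also have "P \<star> (ext_rep x \<star> ext_rep y) = (P \<star> \<pi> a) \<star> (P \<star> \<pi> c)"
  proof -
    have "P \<star> (ext_rep x \<star> ext_rep y) = (P \<star> \<pi> a) \<star> ext_rep y"
      using P_ext_rep(1)[OF a(1,2)] by (simp add: a(3) flip: blinfun_compose_assoc)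
    also have "P \<star> \<pi> a = (P \<star> \<pi> a) \<star> P"
      using projectionD(3)[OF P_projection] P_commutes[OF a(1)] by (metis blinfun_compose_assoc)
    also have "\<dots> \<star> ext_rep y = (P \<star> \<pi> a) \<star> (P \<star> \<pi> c)"
      using P_ext_rep(1)[OF c(1,2)] by (simp only: c(3) blinfun_compose_assoc)
    finally show ?thesis .
  qed
  also have "P' \<star> (ext_rep x \<star> ext_rep y) = (P' \<star> \<pi> b) \<star> (P' \<star> \<pi> d)"
  proof -
    have "P' \<star> (ext_rep x \<star> ext_rep y) = (P' \<star> \<pi> b) \<star> ext_rep y"
      using P_ext_rep(2)[OF a(1,2)] by (simp add: a(3) flip: blinfun_compose_assoc)
    also have "P' \<star> \<pi> b = (P' \<star> \<pi> b) \<star> P'"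
      using projectionD(3)[OF fin.proj] fin.commutes[OF a(2)] by (metis blinfun_compose_assoc)
    also have "\<dots> \<star> ext_rep y = (P' \<star> \<pi> b) \<star> (P' \<star> \<pi> d)"
      using P_ext_rep(2)[OF c(1,2)] by (simp only: c(3) blinfun_compose_assoc)
    finally show ?thesis .
  qed
  finally show "ext_rep (x \<otimes>\<^bsub>B\<^esub> y) = ext_rep x \<star> ext_rep y"
    using a c by (simp add: B_ops ext_rep_elem init.compress_mult fin.compress_mult)
qed

lemma ext_rep_inj: "inj_on ext_rep (carrier B)"
proof (rule inj_onI)
  fix x y assume x: "x \<in> carrier B" and y: "y \<in> carrier B" and eq: "ext_rep x = ext_rep y"
  obtain a b where a: "a \<in> carrier A" "b \<in> carrier A" "x = elem a b" using x B_carrier by auto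
  obtain c d where c: "c \<in> carrier A" "d \<in> carrier A" "y = elem c d" using y B_carrier by auto
  note * = a c
  have eq': "ext_rep (elem a b) = ext_rep (elem c d)" using eq *(3,6) by simp
  have "P \<star> \<pi> a = P \<star> \<pi> c" "P' \<star> \<pi> b = P' \<star> \<pi> d"
    unfolding P_ext_rep[OF *(1,2), symmetric] P_ext_rep[OF *(4,5), symmetric] eq' by (rule refl)+
  thus "x = y" unfolding *(3,6) using init.coset_eq_iff[OF *(1,4)] fin.coset_eq_iff[OF *(2,5)] by blast
qed

lemma ext_rep_image:
  "ext_rep ` carrier B = {P \<star> x + P' \<star> y |x y. x \<in> \<pi> ` carrier A \<and> y \<in> \<pi> ` carrier A}"
proof (intro equalityI subsetI)
  fix T assume "T \<in> ext_rep ` carrier B"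
  then obtain x where x: "x \<in> carrier B" "T = ext_rep x" by (rule imageE)
  obtain a b where a: "a \<in> carrier A" "b \<in> carrier A" "x = elem a b" using x(1) B_carrier by auto
  have "T = P \<star> \<pi> a + P' \<star> \<pi> b" using x(2) a by (simp add: ext_rep_elem)
  thus "T \<in> {P \<star> x + P' \<star> y |x y. x \<in> \<pi> ` carrier A \<and> y \<in> \<pi> ` carrier A}"
    using a(1,2) by blast
next
  fix T assume "T \<in> {P \<star> x + P' \<star> y |x y. x \<in> \<pi> ` carrier A \<and> y \<in> \<pi> ` carrier A}"
  then obtain a b where "a \<in> carrier A" "b \<in> carrier A" "T = P \<star> \<pi> a + P' \<star> \<pi> b" by blast
  hence "T = ext_rep (elem a b)" "elem a b \<in> carrier B" by (simp_all add: ext_rep_elem)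
  thus "T \<in> ext_rep ` carrier B" by (rule image_eqI)
qed

lemma ext_rep_diag: "a \<in> carrier A \<Longrightarrow> ext_rep (elem a a) = \<pi> a"
  by (rule blinfun_eqI) (simp add: ext_rep_elem blinfun.bilinear_simps)

lemma ext_rep_corner: "ext_rep (elem \<one> \<zero>) = P" "ext_rep (elem \<zero> \<one>) = P'"
  by (simp_all add: ext_rep_elem rep.pi_one rep.pi_zero)

lemma B_closed:
  assumes "x \<in> carrier B"
  shows "y \<in> carrier B \<Longrightarrow> x \<oplus>\<^bsub>B\<^esub> y \<in> carrier B" "y \<in> carrier B \<Longrightarrow> x \<otimes>\<^bsub>B\<^esub> y \<in> carrier B"
    "cscale B c x \<in> carrier B" "star B x \<in> carrier B"
proof -
  obtain a b where a: "a \<in> carrier A" "b \<in> carrier A" "x = elem a b" using assms B_carrier by auto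
  show "cscale B c x \<in> carrier B" "star B x \<in> carrier B"
    using a(1,2) unfolding a(3) by (simp_all only: B_ops elem_closed cscale_closed star_closed)
  assume "y \<in> carrier B"
  then obtain c d where c: "c \<in> carrier A" "d \<in> carrier A" "y = elem c d" using B_carrier by auto
  show "x \<oplus>\<^bsub>B\<^esub> y \<in> carrier B" "x \<otimes>\<^bsub>B\<^esub> y \<in> carrier B"
    using a(1,2) c(1,2) unfolding a(3) c(3) by (simp_all only: B_ops elem_closed add.m_closed m_closed)
qed

lemma B_cstar_algebra: "cstar_algebra B"
proof (rule cstar_algebraI_isometric[where \<rho> = ext_rep])
  show "closed (ext_rep ` carrier B)"
    unfolding ext_rep_image by (rule init.comp.closed_compress_sums)
qed (simp_all add: ext_rep_inj ext_rep_ops B_closed B_units ext_rep_diag rep.pi_zero rep.pi_one)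

lemma ext_endo_elem:
  assumes "a \<in> carrier A" "b \<in> carrier A"
  shows "\<delta>B (elem a b) = elem (\<delta> a) (\<delta> a)"
proof -
  have "\<delta> x = \<delta> a" if "x \<in> carrier A" "P \<star> \<pi> x = P \<star> \<pi> a" for x
  proof -
    have "\<pi> (\<delta> y) = U \<star> (P \<star> \<pi> y) \<star> U\<^sup>\<dagger>" if "y \<in> carrier A" for y
      using covariance[OF that] UP by (simp flip: blinfun_compose_assoc)
    hence "\<pi> (\<delta> x) = \<pi> (\<delta> a)" using that assms(1) by simp
    thus ?thesis using that assms(1) rep.pi_eq_iff by simp
  qed
  hence "(\<Union>x\<in>init.K +> a. init.K +> \<delta> x) = init.K +> \<delta> a"
    "(\<Union>x\<in>init.K +> a. fin.K +> \<delta> x) = fin.K +> \<delta> a"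
    by (auto intro!: init.UN_coset assms(1) arg_cong[where f = "(+>) _"])
  thus ?thesis by (simp add: ext_endo_def flip: kernel_delta)
qed

lemma ext_endo_closed:
  assumes "x \<in> carrier B"
  shows "\<delta>B x \<in> carrier B"
proof -
  obtain a b where a: "a \<in> carrier A" "b \<in> carrier A" "x = elem a b" using assms B_carrier by auto
  show ?thesis using a(1,2) unfolding a(3) by (simp only: ext_endo_elem elem_closed delta_closed)
qed

lemma ext_rep_covariance:
  assumes "x \<in> carrier B"
  shows "U \<star> ext_rep x \<star> U\<^sup>\<dagger> = ext_rep (\<delta>B x)"
proof -
  obtain a b where a: "a \<in> carrier A" "b \<in> carrier A" "x = elem a b" using assms B_carrier by auto
  have "U \<star> ext_rep x = U \<star> (P \<star> ext_rep x)" using UP by (simp flip: blinfun_compose_assoc)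
  also have "\<dots> = U \<star> \<pi> a" using P_ext_rep(1)[OF a(1,2)] UP a(3) by (simp flip: blinfun_compose_assoc)
  finally show ?thesis using a covariance[OF a(1)] by (simp add: ext_endo_elem ext_rep_diag)
qed

text \<open>The identities are tested under the injective map \<open>ext_rep\<close>, where \<open>ext_endo\<close> becomes \<open>T \<mapsto> U T U\<^sup>\<dagger>\<close>.
  That map is multiplicative on operators that commute with \<open>P = U\<^sup>\<dagger>U\<close>.\<close>

lemma ext_endo_star_hom: "\<delta>B \<in> star_hom B B"
proof -
  have eqI: "x = y" if "ext_rep x = ext_rep y" "x \<in> carrier B" "y \<in> carrier B" for x y
    using inj_onD[OF ext_rep_inj] that by blast
  note rules = ext_endo_closed B_closed ext_rep_ops ext_rep_covariance[symmetric]
  have "\<delta>B (x \<oplus>\<^bsub>B\<^esub> y) = \<delta>B x \<oplus>\<^bsub>B\<^esub> \<delta>B y" if "x \<in> carrier B" "y \<in> carrier B" for x y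
    by (rule eqI) (simp_all add: rules that, rule blinfun_eqI, simp add: blinfun.bilinear_simps)
  moreover have "\<delta>B (x \<otimes>\<^bsub>B\<^esub> y) = \<delta>B x \<otimes>\<^bsub>B\<^esub> \<delta>B y" if "x \<in> carrier B" "y \<in> carrier B" for x y
  proof (rule eqI)
    have "(U \<star> ext_rep x \<star> U\<^sup>\<dagger>) \<star> (U \<star> ext_rep y \<star> U\<^sup>\<dagger>) = U \<star> (ext_rep x \<star> P) \<star> ext_rep y \<star> U\<^sup>\<dagger>"
      by (simp add: blinfun_compose_assoc)
    also have "\<dots> = (U \<star> P) \<star> ext_rep x \<star> ext_rep y \<star> U\<^sup>\<dagger>"
      unfolding ext_rep_ops(7)[OF that(1), symmetric] by (simp add: blinfun_compose_assoc)
    finally show "ext_rep (\<delta>B (x \<otimes>\<^bsub>B\<^esub> y)) = ext_rep (\<delta>B x \<otimes>\<^bsub>B\<^esub> \<delta>B y)"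
      using that by (simp add: rules UP) (simp add: blinfun_compose_assoc)
  qed (simp_all add: rules that)
  moreover have "\<delta>B (cscale B c x) = cscale B c (\<delta>B x)" if x: "x \<in> carrier B" for c x
  proof -
    have lin: "blinfun_apply U (c *\<^sub>C v) = c *\<^sub>C blinfun_apply U v" for v
      using U_bop carrier_bop by blast
    show ?thesis
      by (rule eqI) (simp_all add: rules x, rule blinfun_eqI, simp add: blinfun_apply_cscale lin)
  qed
  moreover have "\<delta>B (star B x) = star B (\<delta>B x)" if "x \<in> carrier B" for x
    by (rule eqI) (simp_all add: rules that hadjoint_compose blinfun_compose_assoc)
  ultimately show ?thesis by (auto simp: star_hom_def ext_endo_closed)
qed

abbreviation "G \<equiv> cstar_generated bop_alg (\<pi> ` carrier A \<union> {P})"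

text \<open>Closedness of the image is where completeness of the compressed algebras enters.\<close>

lemma ext_rep_image_subalgebra: "cstar_subalgebra bop_alg (ext_rep ` carrier B)"
proof -
  let ?E = "ext_rep ` carrier B"
  have E_bop: "?E \<subseteq> carrier bop_alg" by (rule image_subsetI) (rule ext_rep_ops(1))
  have zero: "0 \<in> ?E"
    by (rule image_eqI[of _ _ "elem \<zero> \<zero>"]) (simp_all add: ext_rep_diag rep.pi_zero)
  have binary: "x + y \<in> ?E \<and> x \<star> y \<in> ?E" if x: "x \<in> ?E" and y: "y \<in> ?E" for x y
  proof -
    obtain u where u: "x = ext_rep u" "u \<in> carrier B" using x by (rule imageE)
    obtain v where v: "y = ext_rep v" "v \<in> carrier B" using y by (rule imageE)
    show ?thesis
      using imageI[OF B_closed(1)[OF u(2) v(2)], of ext_rep] imageI[OF B_closed(2)[OF u(2) v(2)], of ext_rep]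
        u v by (simp add: ext_rep_ops)
  qed
  have unary: "cscale bop_alg c x \<in> ?E \<and> x\<^sup>\<dagger> \<in> ?E" if x: "x \<in> ?E" for c x
  proof -
    obtain u where u: "x = ext_rep u" "u \<in> carrier B" using x by (rule imageE)
    show ?thesis
      using imageI[OF B_closed(3)[OF u(2)], of ext_rep c] imageI[OF B_closed(4)[OF u(2)], of ext_rep]
        u by (simp add: ext_rep_ops)
  qed
  have "norm_closed bop_alg ?E"
    using norm_closed_bop[OF _ E_bop] init.comp.closed_compress_sums by (simp add: ext_rep_image)
  thus ?thesis
    unfolding cstar_subalgebra_def bop_simps using E_bop zero binary unary by (intro conjI ballI allI) simp_all
qed

lemma G_carrier: "carrier G = ext_rep ` carrier B"
proof -
  let ?X = "\<pi> ` carrier A \<union> {P}"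
  have "\<pi> ` carrier A \<subseteq> ext_rep ` carrier B"
  proof (rule image_subsetI)
    fix a assume "a \<in> carrier A"
    thus "\<pi> a \<in> ext_rep ` carrier B"
      by (intro image_eqI[of _ _ "elem a a"]) (simp_all add: ext_rep_diag)
  qed
  moreover have "P \<in> ext_rep ` carrier B"
    by (rule image_eqI[of _ _ "elem \<one> \<zero>"]) (simp_all only: ext_rep_corner elem_closed one_closed zero_closed)
  ultimately have X: "?X \<subseteq> ext_rep ` carrier B" by simp
  have least: "ext_rep ` carrier B \<subseteq> S" if sub: "cstar_subalgebra bop_alg S" and S: "?X \<subseteq> S" for S
  proof (rule image_subsetI)
    fix x assume "x \<in> carrier B"
    then obtain a b where a: "a \<in> carrier A" "b \<in> carrier A" "x = elem a b" using B_carrier by auto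
    have add: "T + T' \<in> S" if "T \<in> S" "T' \<in> S" for T T'
      using sub that by (simp add: cstar_subalgebra_def)
    have mult: "T \<star> T' \<in> S" if "T \<in> S" "T' \<in> S" for T T'
      using sub that by (simp add: cstar_subalgebra_def)
    have scale: "cscale bop_alg c T \<in> S" if "T \<in> S" for c T
      using sub that by (simp add: cstar_subalgebra_def)
    have mem: "P \<in> S" "\<pi> a \<in> S" "\<pi> b \<in> S" using S a by auto
    have "\<pi> \<one> \<in> S" using S by auto
    hence "id_blinfun + cscale bop_alg (- 1) P \<in> S"
      unfolding rep.pi_one by (intro add scale mem)
    moreover have "id_blinfun + cscale bop_alg (- 1) P = P'"
      by (rule blinfun_eqI) (simp add: blinfun_apply_cscale blinfun.bilinear_simps scaleC_minus_one)
    ultimately have "P' \<in> S" by simp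
    thus "ext_rep x \<in> S" unfolding a(3) ext_rep_elem[OF a(1,2)] by (intro add mult mem)
  qed
  have "\<Inter>{S. cstar_subalgebra bop_alg S \<and> ?X \<subseteq> S} = ext_rep ` carrier B"
  proof (rule equalityI)
    show "\<Inter>{S. cstar_subalgebra bop_alg S \<and> ?X \<subseteq> S} \<subseteq> ext_rep ` carrier B"
      using ext_rep_image_subalgebra X by (intro Inter_lower) simp
    show "ext_rep ` carrier B \<subseteq> \<Inter>{S. cstar_subalgebra bop_alg S \<and> ?X \<subseteq> S}"
      using least by (intro Inter_greatest) simp
  qed
  thus ?thesis by (simp add: cstar_generated_def)
qed

lemma G_sel: "mult G = (\<star>)" "add G = (+)" "cscale G = cscale bop_alg" "star G = hadjoint"
  by (simp_all add: cstar_generated_def)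

lemma ext_rep_star_hom: "ext_rep \<in> star_hom B bop_alg"
  by (simp add: star_hom_def ext_rep_ops)

lemma ext_rep_star_iso: "ext_rep \<in> star_iso B G"
  unfolding star_iso_def star_hom_def G_carrier G_sel bij_betw_def
  using ext_rep_inj by (simp add: ext_rep_ops)

lemma ext_rep_covariant: "covariant_representation B \<delta>B ext_rep U"
proof -
  interpret B: cstar_algebra B by (rule B_cstar_algebra)
  show ?thesis
  proof
    show "\<delta>B \<in> star_hom B B" by (rule ext_endo_star_hom)
    show "ext_rep \<in> star_hom B bop_alg" by (rule ext_rep_star_hom)
    show "inj_on ext_rep (carrier B)" by (rule ext_rep_inj)
    show "partial_isometry U" by (rule partial_isometry)
    show "U \<star> ext_rep x \<star> U\<^sup>\<dagger> = ext_rep (\<delta>B x)" if "x \<in> carrier B" for x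
      by (rule ext_rep_covariance[OF that])
    show "P \<in> commutant (ext_rep ` carrier B)"
      using projectionD(1)[OF P_projection] ext_rep_ops(7) by (auto simp: commutant_def)
    have "{blinfun_apply (\<pi> a) h |a h. a \<in> carrier A} \<subseteq> {blinfun_apply (ext_rep x) h |x h. x \<in> carrier B}"
    proof
      fix v assume "v \<in> {blinfun_apply (\<pi> a) h |a h. a \<in> carrier A}"
      then obtain a h where "a \<in> carrier A" "v = blinfun_apply (\<pi> a) h" by blast
      hence "elem a a \<in> carrier B" "v = blinfun_apply (ext_rep (elem a a)) h" by (simp_all add: ext_rep_diag)
      thus "v \<in> {blinfun_apply (ext_rep x) h |x h. x \<in> carrier B}" by blast
    qed
    from closure_mono[OF span_mono[OF this]]
    show "closure (span {blinfun_apply (ext_rep x) h |x h. x \<in> carrier B}) = UNIV"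
      using nondegenerate by auto
  qed
qed

lemma ext_rep_extension: "extension_rep A \<delta> \<pi> U fin.K ext_rep"
  unfolding extension_rep_def
  using ext_rep_star_iso ext_rep_covariant by (simp add: ext_embed_def ext_rep_diag flip: kernel_delta)

text \<open>The two central projections of the extension must go to \<open>P\<close> and \<open>P'\<close>, and together with the copy of \<open>A\<close>
  they generate. Covariance turns the kernel of \<open>ext_endo\<close> into the elements whose image is killed by
  \<open>P\<close>. Applied to \<open>(0, 1)\<close> this bounds its image by \<open>P'\<close>; applied to a preimage of \<open>P'\<close>, which exists
  because \<open>\<sigma>\<close> is onto the generated algebra, it shows that this preimage is a multiple of \<open>(0, 1)\<close>.\<close>

lemma extension_unique:
  assumes \<sigma>: "extension_rep A \<delta> \<pi> U fin.K \<sigma>" and x: "x \<in> carrier B"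
  shows "\<sigma> x = ext_rep x"
proof -
  have diag: "\<sigma> (elem a a) = \<pi> a" if "a \<in> carrier A" for a
    using \<sigma> that by (simp add: extension_rep_def ext_embed_def flip: kernel_delta)
  have iso: "\<sigma> \<in> star_iso B G" and "covariant_representation B \<delta>B \<sigma> U"
    using \<sigma> by (simp_all add: extension_rep_def)
  interpret \<sigma>: covariant_representation B \<delta>B \<sigma> U by fact
  note hom = star_hom_bopD[OF \<sigma>.representation]
  have kill: "P \<star> \<sigma> z = 0 \<longleftrightarrow> \<delta>B z = elem \<zero> \<zero>" if z: "z \<in> carrier B" for z
  proof -
    have "P \<star> \<sigma> z = 0 \<longleftrightarrow> \<sigma> (\<delta>B z) = 0"
      using conj_eq_zero_iff[OF \<sigma>.P_commutes[OF z]] \<sigma>.covariance[OF z] by simp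
    also have "\<dots> \<longleftrightarrow> \<sigma> (\<delta>B z) = \<sigma> (elem \<zero> \<zero>)" by (simp add: diag rep.pi_zero)
    also have "\<dots> \<longleftrightarrow> \<delta>B z = elem \<zero> \<zero>"
      by (rule \<sigma>.rep.pi_eq_iff) (simp_all add: ext_endo_closed z)
    finally show ?thesis .
  qed
  have "\<pi> (\<delta> \<zero>) = \<pi> \<zero>"
    unfolding covariance[OF zero_closed, symmetric] by (simp add: rep.pi_zero)
  hence "\<delta> \<zero> = \<zero>" by (subst (asm) rep.pi_eq_iff) simp_all
  hence "\<delta>B (elem \<zero> \<one>) = elem \<zero> \<zero>" by (simp only: ext_endo_elem zero_closed one_closed)
  hence lower: "P \<star> \<sigma> (elem \<zero> \<one>) = 0"
    by (rule iffD2[OF kill[OF elem_closed[OF zero_closed one_closed]]])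
  have "P' \<in> \<sigma> ` carrier B"
  proof -
    have "ext_rep (elem \<zero> \<one>) \<in> carrier G"
      unfolding G_carrier by (intro imageI elem_closed) simp_all
    hence "P' \<in> carrier G" by (simp only: ext_rep_corner)
    moreover have "bij_betw \<sigma> (carrier B) (carrier G)"
      using iso unfolding star_iso_def mem_Collect_eq by (rule conjunct2)
    ultimately show ?thesis by (simp only: bij_betw_imp_surj_on)
  qed
  then obtain z where z: "P' = \<sigma> z" "z \<in> carrier B" by (rule imageE)
  obtain a b where a: "a \<in> carrier A" "b \<in> carrier A" "z = elem a b" using z(2) B_carrier by auto
  note ab = a(1,2) z(1)[unfolded a(3), symmetric]
  have "P \<star> P' = P - P \<star> P"
    by (simp only: bounded_bilinear.diff_right[OF bounded_bilinear_blinfun_compose] blinfun_compose_id)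
  hence "P \<star> \<sigma> (elem a b) = 0" by (simp only: ab(3) projectionD(3)[OF P_projection] diff_self)
  hence "\<delta>B (elem a b) = elem \<zero> \<zero>" using kill[OF elem_closed[OF ab(1,2)]] by (rule iffD1[rotated])
  hence "init.K +> \<delta> a = init.K +> \<zero>" "fin.K +> \<delta> a = fin.K +> \<zero>"
    unfolding ext_endo_elem[OF ab(1,2)] by simp_all
  hence "P \<star> \<pi> (\<delta> a) = 0" "P' \<star> \<pi> (\<delta> a) = 0"
    using init.coset_eq_iff[OF delta_closed[OF ab(1)] zero_closed]
      fin.coset_eq_iff[OF delta_closed[OF ab(1)] zero_closed]
    by (simp_all only: rep.pi_zero blinfun_compose_zero)
  hence "\<delta> a \<in> init.K \<inter> fin.K"
    using delta_closed[OF ab(1)]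
    unfolding init.compression_kernel_def fin.compression_kernel_def by blast
  hence "\<delta> a = \<zero>" unfolding kernels_disjoint by (rule singletonD)
  hence "a \<in> init.K" using ab(1) unfolding kernel_delta a_kernel_def' by blast
  hence "P \<star> \<pi> a = P \<star> \<pi> \<zero>"
    unfolding init.compression_kernel_def by (simp add: rep.pi_zero)
  hence "init.K +> a = init.K +> \<zero>" using init.coset_eq_iff[OF ab(1) zero_closed] by blast
  hence "elem a b \<otimes>\<^bsub>B\<^esub> elem \<zero> \<one> = elem a b"
    using ab by (simp add: B_ops)
  hence "P' = P' \<star> \<sigma> (elem \<zero> \<one>)" using hom(3)[of "elem a b" "elem \<zero> \<one>"] ab by simp
  also have "\<dots> = \<sigma> (elem \<zero> \<one>) - P \<star> \<sigma> (elem \<zero> \<one>)"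
    by (rule blinfun_eqI) (simp add: blinfun.bilinear_simps)
  finally have corner0: "\<sigma> (elem \<zero> \<one>) = P'" by (simp add: lower)
  have "elem \<one> \<zero> \<oplus>\<^bsub>B\<^esub> elem \<zero> \<one> = elem \<one> \<one>" by (simp add: B_ops)
  hence "\<sigma> (elem \<one> \<zero>) + P' = id_blinfun"
    using hom(2)[of "elem \<one> \<zero>" "elem \<zero> \<one>"] by (simp add: corner0 diag rep.pi_one)
  hence corner1: "\<sigma> (elem \<one> \<zero>) = P" by (simp add: algebra_simps)
  obtain c d where c: "c \<in> carrier A" "d \<in> carrier A" "x = elem c d" using x B_carrier by auto
  have "x = elem \<one> \<zero> \<otimes>\<^bsub>B\<^esub> elem c c \<oplus>\<^bsub>B\<^esub> elem \<zero> \<one> \<otimes>\<^bsub>B\<^esub> elem d d"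
    using c by (simp add: B_ops)
  hence "\<sigma> x = P \<star> \<pi> c + P' \<star> \<pi> d"
    using c by (simp add: hom(2) hom(3) B_closed corner0 corner1 diag)
  thus ?thesis using c by (simp add: ext_rep_elem)
qed

end

theorem proposition1p2:
  fixes A :: "'a cstar_alg"
    and \<delta> :: "'a \<Rightarrow> 'a"
    and \<pi> :: "'a \<Rightarrow> ('h::chilbert_space \<Rightarrow>\<^sub>L 'h)"
    and U :: "'h \<Rightarrow>\<^sub>L 'h"
    and I J :: "'a set"
  assumes "covariant_representation A \<delta> \<pi> U"
    and "I = {a \<in> carrier A. (id_blinfun - (U\<^sup>\<dagger> o\<^sub>L U)) o\<^sub>L \<pi> a = \<pi> a}"
    and "J = {a \<in> carrier A. (U\<^sup>\<dagger> o\<^sub>L U) o\<^sub>L \<pi> a = \<pi> a}"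
  shows "I = a_kernel A A \<delta> \<and>
    orthogonal_ideals A I J \<and>
    (\<exists>\<rho>. extension_rep A \<delta> \<pi> U J \<rho> \<and>
      (\<forall>\<sigma>. extension_rep A \<delta> \<pi> U J \<sigma> \<longrightarrow> (\<forall>x\<in>carrier (ext_alg A \<delta> J). \<sigma> x = \<rho> x)) \<and>
      (\<forall>a\<in>carrier A. \<forall>b\<in>carrier A.
         \<rho> (I +>\<^bsub>A\<^esub> a, J +>\<^bsub>A\<^esub> b)
           = ((U\<^sup>\<dagger> o\<^sub>L U) o\<^sub>L \<pi> a) + ((id_blinfun - (U\<^sup>\<dagger> o\<^sub>L U)) o\<^sub>L \<pi> b)))"
proof -
  interpret covariant_representation A \<delta> \<pi> U by fact
  have P': "P' \<star> T = T - P \<star> T" for T :: "'h \<Rightarrow>\<^sub>L 'h"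
    by (rule blinfun_eqI) (simp add: blinfun.bilinear_simps)
  have I: "I = init.K"
    unfolding assms(2) init.compression_kernel_def P' by auto
  have J: "J = fin.K"
    unfolding assms(3) fin.compression_kernel_def P' by auto
  have "orthogonal_ideals A init.K fin.K"
    unfolding orthogonal_ideals_def closed_ideal_def
    using init.kernel_ideal fin.kernel_ideal init.kernel_closed fin.kernel_closed kernels_disjoint by blast
  moreover have "\<forall>\<sigma>. extension_rep A \<delta> \<pi> U fin.K \<sigma> \<longrightarrow> (\<forall>x\<in>carrier B. \<sigma> x = ext_rep x)"
    using extension_unique by blast
  moreover have "\<forall>a\<in>carrier A. \<forall>b\<in>carrier A. ext_rep (elem a b) = P \<star> \<pi> a + P' \<star> \<pi> b"
    using ext_rep_elem by blast
  ultimately show ?thesis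
    unfolding I J using kernel_delta ext_rep_extension by blast
qed

end
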